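(* Let $\mathsf G$ be a discrete group that is rigidly $\mathcal L$-symmetric for some admissible algebra $\mathcal L(\mathsf G)$, and let $\mathcal A(\mathsf G)$ be a unital $C^*$-subalgebra of $\ell^\infty(\mathsf G)$ which is invariant under translations. Then the Banach $*$-algebra $\mathfrak K^{\mathcal L,\mathcal A}_{\omega}(\mathsf G\times\mathsf G)$ of twisted kernels is symmetric for every $2$-cocycle $\omega:\mathsf G\times\mathsf G\to\mathcal A(\mathsf G)$.
   Context: Banach $*$-algebras have submultiplicative norm and isometric involution; such an algebra is symmetric if the spectrum of $B^*B$ is contained in $[0,\infty)$ for every element $B$ (spectrum in the unitization if there is no unit). For a discrete group $\mathsf G$ with unit $\mathsf e$, $\ell^1(\mathsf G)$ has product $(k\star l)(x)=\sum_{y}k(y)l(y^{-1}x)$ and involution $k^\star(x)=\overline{k(x^{-1})}$. An admissible algebra is a subspace $\mathcal L(\mathsf G)\subset\ell^1(\mathsf G)$ with its own complete norm $\|\cdot\|_{\mathcal L}$, stronger than the $\ell^1$-norm, such that (i) it is solid: if $|k(x)|\le|l(x)|$ for all $x$ and $l\in\mathcal L(\mathsf G)$, then $k\in\mathcal L(\mathsf G)$ and $\|k\|_{\mathcal L}\le\|l\|_{\mathcal L}$; (ii) $(\mathcal L(\mathsf G),\star,{}^\star,\|\cdot\|_{\mathcal L})$ is a unital Banach $*$-algebra. $\mathsf G$ is rigidly $\mathcal L$-symmetric if for every $C^*$-algebra $\mathcal B$ the Banach $*$-algebra $\mathcal L(\mathsf G;\mathcal B)=\{f\in\ell^1(\mathsf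 G;\mathcal B)\mid\|f(\cdot)\|_{\mathcal B}\in\mathcal L(\mathsf G)\}$, with norm $\big\|\,\|f(\cdot)\|_{\mathcal B}\big\|_{\mathcal L}$, convolution $(f\star g)(x)=\sum_yf(y)g(y^{-1}x)$ and involution $f^\star(x)=f(x^{-1})^*$, is symmetric. Translations: $[\alpha_x(\varphi)](y)=\varphi(x^{-1}y)$; invariance under translations means $\alpha_x(\mathcal A(\mathsf G))\subset\mathcal A(\mathsf G)$ for all $x$. A $2$-cocycle $\omega:\mathsf G\times\mathsf G\to\mathcal A(\mathsf G)$ is a map with unitary (i.e. $\mathbb T$-valued) values satisfying $\omega(x,y)\omega(xy,z)=\alpha_x[\omega(y,z)]\omega(x,yz)$ and $\omega(x,\mathsf e)=1=\omega(\mathsf e,x)$; write $\omega(x,y;q):=[\omega(x,y)](q)$. $\mathfrak K^{\mathcal L,\mathcal A}_{\omega}(\mathsf G\times\mathsf G)$ is the set of kernels $\mathsf K:\mathsf G\times\mathsf G\to\mathbb C$ such that for some $k\in\mathcal L(\mathsf G)$ one has $|\mathsf K(x,y)|\le|k(xy^{-1})|$ for all $x,y$, and such that $z\mapsto\mathsf K(xz,yz)$ belongs to $\mathcal A(\mathsf G)$ for all $x,y\in\mathsf G$. It is a Banach $*$-algebra with norm $\|\mathsf K\|=\inf\{\|k\|_{\mathcal L}\mid k\in\mathcal L(\mathsf G),\ |\mathsf K(x,y)|\le|k(xy^{-1})|\ \forall x,y\}$, product $(\mathsf K\bullet_\omega\mathsf L)(x,y)=\sum_{z\in\mathsf G}\mathsf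 K(x,z)\mathsf L(z,y)\,\omega(xz^{-1},zy^{-1};x)$ and involution $\mathsf K^{\bullet_\omega}(x,y)=\overline{\omega(xy^{-1},yx^{-1};x)}\;\overline{\mathsf K(y,x)}$. *)

theory Defs
  imports "HOL-Analysis.Analysis" "HOL-Algebra.Module"
begin

section \<open>Banach *-algebras and C*-algebras on carrier sets\<close>

text \<open>
  The algebras below are not assumed to be unital. The field \<open>one\<close> inherited from the ring record
  is meaningful only if a unit exists: axiom \<open>one_unique\<close> of \<open>banach_star_algebra\<close> says that any
  unit is equal to \<open>one\<close>. Hence \<open>monoid A\<close> holds iff \<open>A\<close> is unital.
\<close>

record 'a star_algebra = "(complex, 'a) module" +
  invol :: "'a \<Rightarrow> 'a"
  anorm :: "'a \<Rightarrow> real"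

definition complex_ring :: "complex ring" where
  "complex_ring = \<lparr>carrier = UNIV, mult = (*), one = 1, zero = 0, add = (+)\<rparr>"

locale banach_star_algebra = module complex_ring A
  for A :: "('a, 'm) star_algebra_scheme" +
  assumes mult_closed: "\<And>a b. a \<in> carrier A \<Longrightarrow> b \<in> carrier A \<Longrightarrow> a \<otimes>\<^bsub>A\<^esub> b \<in> carrier A"
    and mult_assoc: "\<And>a b c. a \<in> carrier A \<Longrightarrow> b \<in> carrier A \<Longrightarrow> c \<in> carrier A \<Longrightarrow>
      (a \<otimes>\<^bsub>A\<^esub> b) \<otimes>\<^bsub>A\<^esub> c = a \<otimes>\<^bsub>A\<^esub> (b \<otimes>\<^bsub>A\<^esub> c)"
    and mult_add_left: "\<And>a b c. a \<in> carrier A \<Longrightarrow> b \<in> carrier A \<Longrightarrow> c \<in> carrier A \<Longrightarrow>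
      (a \<oplus>\<^bsub>A\<^esub> b) \<otimes>\<^bsub>A\<^esub> c = a \<otimes>\<^bsub>A\<^esub> c \<oplus>\<^bsub>A\<^esub> b \<otimes>\<^bsub>A\<^esub> c"
    and mult_add_right: "\<And>a b c. a \<in> carrier A \<Longrightarrow> b \<in> carrier A \<Longrightarrow> c \<in> carrier A \<Longrightarrow>
      a \<otimes>\<^bsub>A\<^esub> (b \<oplus>\<^bsub>A\<^esub> c) = a \<otimes>\<^bsub>A\<^esub> b \<oplus>\<^bsub>A\<^esub> a \<otimes>\<^bsub>A\<^esub> c"
    and mult_smult_left: "\<And>z a b. a \<in> carrier A \<Longrightarrow> b \<in> carrier A \<Longrightarrow>
      (z \<odot>\<^bsub>A\<^esub> a) \<otimes>\<^bsub>A\<^esub> b = z \<odot>\<^bsub>A\<^esub> (a \<otimes>\<^bsub>A\<^esub> b)"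
    and mult_smult_right: "\<And>z a b. a \<in> carrier A \<Longrightarrow> b \<in> carrier A \<Longrightarrow>
      a \<otimes>\<^bsub>A\<^esub> (z \<odot>\<^bsub>A\<^esub> b) = z \<odot>\<^bsub>A\<^esub> (a \<otimes>\<^bsub>A\<^esub> b)"
    and one_unique: "\<And>u. u \<in> carrier A \<Longrightarrow>
      (\<And>a. a \<in> carrier A \<Longrightarrow> u \<otimes>\<^bsub>A\<^esub> a = a \<and> a \<otimes>\<^bsub>A\<^esub> u = a) \<Longrightarrow> u = \<one>\<^bsub>A\<^esub>"
    and invol_closed: "\<And>a. a \<in> carrier A \<Longrightarrow> invol A a \<in> carrier A"
    and invol_invol: "\<And>a. a \<in> carrier A \<Longrightarrow> invol A (invol A a) = a"
    and invol_add: "\<And>a b. a \<in> carrier A \<Longrightarrow> b \<in> carrier A \<Longrightarrow>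
      invol A (a \<oplus>\<^bsub>A\<^esub> b) = invol A a \<oplus>\<^bsub>A\<^esub> invol A b"
    and invol_smult: "\<And>z a. a \<in> carrier A \<Longrightarrow> invol A (z \<odot>\<^bsub>A\<^esub> a) = cnj z \<odot>\<^bsub>A\<^esub> invol A a"
    and invol_mult: "\<And>a b. a \<in> carrier A \<Longrightarrow> b \<in> carrier A \<Longrightarrow>
      invol A (a \<otimes>\<^bsub>A\<^esub> b) = invol A b \<otimes>\<^bsub>A\<^esub> invol A a"
    and anorm_nonneg: "\<And>a. a \<in> carrier A \<Longrightarrow> 0 \<le> anorm A a"
    and anorm_eq_0_iff: "\<And>a. a \<in> carrier A \<Longrightarrow> anorm A a = 0 \<longleftrightarrow> a = \<zero>\<^bsub>A\<^esub>"
    and anorm_triangle: "\<And>a b. a \<in> carrier A \<Longrightarrow> b \<in> carrier A \<Longrightarrow>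
      anorm A (a \<oplus>\<^bsub>A\<^esub> b) \<le> anorm A a + anorm A b"
    and anorm_smult: "\<And>z a. a \<in> carrier A \<Longrightarrow> anorm A (z \<odot>\<^bsub>A\<^esub> a) = cmod z * anorm A a"
    and anorm_mult: "\<And>a b. a \<in> carrier A \<Longrightarrow> b \<in> carrier A \<Longrightarrow>
      anorm A (a \<otimes>\<^bsub>A\<^esub> b) \<le> anorm A a * anorm A b"
    and anorm_invol: "\<And>a. a \<in> carrier A \<Longrightarrow> anorm A (invol A a) = anorm A a"
    and complete: "\<And>X :: nat \<Rightarrow> 'a. (\<And>n. X n \<in> carrier A) \<Longrightarrow>
      (\<And>e. e > 0 \<Longrightarrow> \<exists>M. \<forall>m\<ge>M. \<forall>n\<ge>M. anorm A (X m \<ominus>\<^bsub>A\<^esub> X n) < e) \<Longrightarrow>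
      \<exists>l\<in>carrier A. (\<lambda>n. anorm A (X n \<ominus>\<^bsub>A\<^esub> l)) \<longlonglongrightarrow> 0"

locale cstar_algebra = banach_star_algebra +
  assumes cstar_identity: "\<And>a. a \<in> carrier A \<Longrightarrow> anorm A (invol A a \<otimes>\<^bsub>A\<^esub> a) = (anorm A a)\<^sup>2"

definition unitization :: "('a, 'm) star_algebra_scheme \<Rightarrow> ('a \<times> complex) star_algebra" where
  "unitization A =
    \<lparr>carrier = carrier A \<times> UNIV,
     mult = (\<lambda>(a, s) (b, t). (a \<otimes>\<^bsub>A\<^esub> b \<oplus>\<^bsub>A\<^esub> (s \<odot>\<^bsub>A\<^esub> b \<oplus>\<^bsub>A\<^esub> t \<odot>\<^bsub>A\<^esub> a), s * t)),
     one = (\<zero>\<^bsub>A\<^esub>, 1),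
     zero = (\<zero>\<^bsub>A\<^esub>, 0),
     add = (\<lambda>(a, s) (b, t). (a \<oplus>\<^bsub>A\<^esub> b, s + t)),
     smult = (\<lambda>z (a, s). (z \<odot>\<^bsub>A\<^esub> a, z * s)),
     invol = (\<lambda>(a, s). (invol A a, cnj s)),
     anorm = (\<lambda>(a, s). anorm A a + cmod s)\<rparr>"

definition spectrum_unital :: "('a, 'm) star_algebra_scheme \<Rightarrow> 'a \<Rightarrow> complex set" where
  "spectrum_unital A a = {z. (z \<odot>\<^bsub>A\<^esub> \<one>\<^bsub>A\<^esub>) \<ominus>\<^bsub>A\<^esub> a \<notin> Units A}"

definition spectrum :: "('a, 'm) star_algebra_scheme \<Rightarrow> 'a \<Rightarrow> complex set" where
  "spectrum A a =
    (if monoid A then spectrum_unital A a else spectrum_unital (unitization A) (a, 0))"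

locale symmetric_banach_star_algebra = banach_star_algebra +
  assumes spectrum_nonneg: "\<And>b. b \<in> carrier A \<Longrightarrow> spectrum A (invol A b \<otimes>\<^bsub>A\<^esub> b) \<subseteq> \<real>\<^sub>\<ge>\<^sub>0"

text \<open>Unconditional sums with respect to the norm of \<open>A\<close>.\<close>

definition alg_has_sum :: "('a, 'm) star_algebra_scheme \<Rightarrow> ('i \<Rightarrow> 'a) \<Rightarrow> 'a \<Rightarrow> bool" where
  "alg_has_sum A f s \<longleftrightarrow> s \<in> carrier A \<and>
    ((\<lambda>F. anorm A (finsum A f F \<ominus>\<^bsub>A\<^esub> s)) \<longlongrightarrow> 0) (finite_subsets_at_top UNIV)"

definition alg_infsum :: "('a, 'm) star_algebra_scheme \<Rightarrow> ('i \<Rightarrow> 'a) \<Rightarrow> 'a" where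
  "alg_infsum A f = (THE s. alg_has_sum A f s)"


section \<open>Admissible algebras and rigid symmetry\<close>

text \<open>
  The discrete group is a type of class \<open>group_add\<close>, whose addition need not be commutative.
  In multiplicative notation \<open>x + y\<close>, \<open>- x\<close>, \<open>0\<close> are \<open>x y\<close>, \<open>x\<close> inverse and the unit;
  \<open>x - y\<close> is \<open>x\<close> times the inverse of \<open>y\<close>, and \<open>- y + x\<close> is the inverse of \<open>y\<close> times \<open>x\<close>.
\<close>

definition group_algebra ::
  "('g::group_add \<Rightarrow> complex) set \<Rightarrow> (('g \<Rightarrow> complex) \<Rightarrow> real) \<Rightarrow> ('g \<Rightarrow> complex) star_algebra" where
  "group_algebra L N =
    \<lparr>carrier = L,
     mult = (\<lambda>k l x. \<Sum>\<^sub>\<infinity>y. k y * l (- y + x)),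
     one = (\<lambda>x. if x = 0 then 1 else 0),
     zero = (\<lambda>x. 0),
     add = (\<lambda>k l x. k x + l x),
     smult = (\<lambda>z k x. z * k x),
     invol = (\<lambda>k x. cnj (k (- x))),
     anorm = N\<rparr>"

definition admissible_algebra ::
  "('g::group_add \<Rightarrow> complex) set \<Rightarrow> (('g \<Rightarrow> complex) \<Rightarrow> real) \<Rightarrow> bool" where
  "admissible_algebra L N \<longleftrightarrow>
    (\<forall>k\<in>L. (\<lambda>x. cmod (k x)) summable_on UNIV) \<and>
    (\<exists>C. \<forall>k\<in>L. (\<Sum>\<^sub>\<infinity>x. cmod (k x)) \<le> C * N k) \<and>
    (\<forall>l\<in>L. \<forall>k. (\<forall>x. cmod (k x) \<le> cmod (l x)) \<longrightarrow> k \<in> L \<and> N k \<le> N l) \<and>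
    banach_star_algebra (group_algebra L N) \<and>
    monoid (group_algebra L N)"

definition vector_group_algebra ::
  "('g::group_add \<Rightarrow> complex) set \<Rightarrow> (('g \<Rightarrow> complex) \<Rightarrow> real) \<Rightarrow> ('b, 'm) star_algebra_scheme
    \<Rightarrow> ('g \<Rightarrow> 'b) star_algebra" where
  "vector_group_algebra L N B =
    \<lparr>carrier = {f. (\<forall>x. f x \<in> carrier B) \<and>
                   (\<lambda>x. anorm B (f x)) summable_on UNIV \<and>
                   (\<lambda>x. complex_of_real (anorm B (f x))) \<in> L},
     mult = (\<lambda>f g x. alg_infsum B (\<lambda>y. f y \<otimes>\<^bsub>B\<^esub> g (- y + x))),
     one = (\<lambda>x. if x = 0 then \<one>\<^bsub>B\<^esub> else \<zero>\<^bsub>B\<^esub>),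
     zero = (\<lambda>x. \<zero>\<^bsub>B\<^esub>),
     add = (\<lambda>f g x. f x \<oplus>\<^bsub>B\<^esub> g x),
     smult = (\<lambda>z f x. z \<odot>\<^bsub>B\<^esub> f x),
     invol = (\<lambda>f x. invol B (f (- x))),
     anorm = (\<lambda>f. N (\<lambda>x. complex_of_real (anorm B (f x))))\<rparr>"

text \<open>
  HOL cannot quantify over types inside a formula, so ``every C*-algebra'' ranges over all
  C*-algebras whose underlying set is a subset of the type \<open>'b\<close>. Up to isomorphism these include
  all separable ones as soon as \<open>'b\<close> has at least the cardinality of the continuum, and this makes
  the notion independent of \<open>'b\<close>: an element of \<open>\<ell>\<^sup>1(G; B)\<close> has countable support, so it lies in
  \<open>\<ell>\<^sup>1(G; B\<^sub>0)\<close> for a separable C*-subalgebra \<open>B\<^sub>0\<close> (containing the unit of \<open>B\<close>, if there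
  is one), and, up to the point 0, passing from \<open>L(G; B\<^sub>0)\<close> to \<open>L(G; B)\<close> can only shrink
  spectra.
\<close>

definition rigidly_symmetric ::
  "'b itself \<Rightarrow> ('g::group_add \<Rightarrow> complex) set \<Rightarrow> (('g \<Rightarrow> complex) \<Rightarrow> real) \<Rightarrow> bool" where
  "rigidly_symmetric (_ :: 'b itself) L N \<longleftrightarrow>
    (\<forall>B :: 'b star_algebra. cstar_algebra B \<longrightarrow>
      symmetric_banach_star_algebra (vector_group_algebra L N B))"


section \<open>Twisted kernels\<close>

definition unital_cstar_subalgebra_linf :: "('g \<Rightarrow> complex) set \<Rightarrow> bool" where
  "unital_cstar_subalgebra_linf S \<longleftrightarrow>
    (\<forall>f\<in>S. bounded (range f)) \<and>
    (\<lambda>_. 1) \<in> S \<and>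
    (\<forall>f\<in>S. \<forall>g\<in>S. (\<lambda>x. f x + g x) \<in> S) \<and>
    (\<forall>c. \<forall>f\<in>S. (\<lambda>x. c * f x) \<in> S) \<and>
    (\<forall>f\<in>S. \<forall>g\<in>S. (\<lambda>x. f x * g x) \<in> S) \<and>
    (\<forall>f\<in>S. (\<lambda>x. cnj (f x)) \<in> S) \<and>
    (\<forall>f g. (\<forall>n::nat. f n \<in> S) \<longrightarrow> uniform_limit UNIV f g sequentially \<longrightarrow> g \<in> S)"

definition translate :: "'g::group_add \<Rightarrow> ('g \<Rightarrow> complex) \<Rightarrow> 'g \<Rightarrow> complex" where
  "translate x \<phi> = (\<lambda>y. \<phi> (- x + y))"

definition translation_invariant :: "('g::group_add \<Rightarrow> complex) set \<Rightarrow> bool" where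
  "translation_invariant S \<longleftrightarrow> (\<forall>x. translate x ` S \<subseteq> S)"

definition two_cocycle ::
  "('g::group_add \<Rightarrow> complex) set \<Rightarrow> ('g \<Rightarrow> 'g \<Rightarrow> 'g \<Rightarrow> complex) \<Rightarrow> bool" where
  "two_cocycle S \<omega> \<longleftrightarrow>
    (\<forall>x y. \<omega> x y \<in> S) \<and>
    (\<forall>x y q. cmod (\<omega> x y q) = 1) \<and>
    (\<forall>x y z q. \<omega> x y q * \<omega> (x + y) z q = translate x (\<omega> y z) q * \<omega> x (y + z) q) \<and>
    (\<forall>x q. \<omega> x 0 q = 1 \<and> \<omega> 0 x q = 1)"

definition dominating ::
  "('g::group_add \<Rightarrow> complex) set \<Rightarrow> ('g \<Rightarrow> 'g \<Rightarrow> complex) \<Rightarrow> ('g \<Rightarrow> complex) set" where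
  "dominating L K = {k \<in> L. \<forall>x y. cmod (K x y) \<le> cmod (k (x - y))}"

definition twisted_kernel_algebra ::
  "('g::group_add \<Rightarrow> complex) set \<Rightarrow> (('g \<Rightarrow> complex) \<Rightarrow> real) \<Rightarrow> ('g \<Rightarrow> complex) set
    \<Rightarrow> ('g \<Rightarrow> 'g \<Rightarrow> 'g \<Rightarrow> complex) \<Rightarrow> ('g \<Rightarrow> 'g \<Rightarrow> complex) star_algebra" where
  "twisted_kernel_algebra L N S \<omega> =
    \<lparr>carrier = {K. dominating L K \<noteq> {} \<and> (\<forall>x y. (\<lambda>z. K (x + z) (y + z)) \<in> S)},
     mult = (\<lambda>K M x y. \<Sum>\<^sub>\<infinity>z. K x z * M z y * \<omega> (x - z) (z - y) x),
     one = (\<lambda>x y. if x = y then 1 else 0),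
     zero = (\<lambda>x y. 0),
     add = (\<lambda>K M x y. K x y + M x y),
     smult = (\<lambda>c K x y. c * K x y),
     invol = (\<lambda>K x y. cnj (\<omega> (x - y) (y - x) x) * cnj (K y x)),
     anorm = (\<lambda>K. Inf (N ` dominating L K))\<rparr>"

end

theory Submission
  imports Defs
begin

text \<open>
  The twist is harmless: the phase in the product of kernels is a coboundary on \<open>G \<times> G\<close>, so
  multiplying each kernel entrywise by a unimodular function turns the twisted product and
  involution into the ordinary product and adjoint of matrices (\<open>omega_untwist\<close>). Sending a kernel
  to the family of its diagonals, indexed by \<open>x y\<^sup>-\<^sup>1\<close>, then embeds the twisted kernels into
  \<open>L(G; B)\<close>, where \<open>B\<close> is the C*-algebra of matrices that are bounded on \<open>\<ell>\<^sup>2(G)\<close>. The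
  embedding is multiplicative because the product of the diagonals \<open>a\<close> and \<open>b\<close> lies on the
  diagonal \<open>a b\<close> (\<open>emb_mult_D\<close>). It is isometric because the operator norm of a single diagonal is
  the supremum of its entries, and these suprema form the least function dominating the kernel
  (\<open>opnorm_emb\<close>, \<open>anorm_T\<close>). Its image is closed (\<open>emb_closed_D\<close>).

  Rigid symmetry says that \<open>L(G; B)\<close> is symmetric, and symmetry passes to closed *-subalgebras with
  the same unit: the resolvent of \<open>b\<^sup>* b\<close> is defined in the large algebra on the connected set
  \<open>\<complex> - [0,\<infinity>)\<close>, it lies in the small algebra far out by the Neumann series, and the points where it
  lies in the small algebra form an open and closed subset (\<open>Units_if_resolvent_connected\<close>).
\<close>

section \<open>Neumann series in Banach *-algebras\<close>

lemma complex_ring_simps [simp]: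
  "carrier complex_ring = UNIV" "mult complex_ring = (*)" "one complex_ring = 1"
  "zero complex_ring = 0" "add complex_ring = (+)"
  by (simp_all add: complex_ring_def)

lemma cring_complex_ring: "cring complex_ring"
proof (rule cringI)
  show "abelian_group complex_ring"
    by (rule abelian_groupI) (auto simp: add.assoc add.commute add_eq_0_iff)
  show "comm_monoid complex_ring"
    by (rule comm_monoidI) (auto simp: mult.assoc mult.commute)
qed (auto simp: algebra_simps)

context banach_star_algebra
begin

lemma a_inv_complex_ring [simp]: "\<ominus>\<^bsub>complex_ring\<^esub> z = - z"
  by (rule R.minus_equality) auto

lemma minus_eq_add_smult:
  assumes "a \<in> carrier A" "b \<in> carrier A"
  shows "a \<ominus>\<^bsub>A\<^esub> b = a \<oplus>\<^bsub>A\<^esub> (-1) \<odot>\<^bsub>A\<^esub> b"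
  using smult_l_minus[of 1 b] assms smult_one[of b] by (simp add: a_minus_def)

lemma smult_carrier [simp, intro]: "a \<in> carrier A \<Longrightarrow> z \<odot>\<^bsub>A\<^esub> a \<in> carrier A"
  using smult_closed by simp

lemma anorm_zero [simp]: "anorm A \<zero>\<^bsub>A\<^esub> = 0"
  using anorm_eq_0_iff by auto

lemma anorm_minus_commute:
  assumes "a \<in> carrier A" "b \<in> carrier A"
  shows "anorm A (a \<ominus>\<^bsub>A\<^esub> b) = anorm A (b \<ominus>\<^bsub>A\<^esub> a)"
proof -
  have "a \<ominus>\<^bsub>A\<^esub> b = \<ominus>\<^bsub>A\<^esub> (b \<ominus>\<^bsub>A\<^esub> a)"
    using assms by (simp add: a_minus_def M.minus_add M.a_comm)
  also have "\<dots> = (-1) \<odot>\<^bsub>A\<^esub> (b \<ominus>\<^bsub>A\<^esub> a)"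
    using smult_l_minus[of 1 "b \<ominus>\<^bsub>A\<^esub> a"] assms smult_one[of "b \<ominus>\<^bsub>A\<^esub> a"] by simp
  finally show ?thesis using assms by (simp add: anorm_smult)
qed

lemma anorm_minus_le:
  assumes "a \<in> carrier A" "b \<in> carrier A"
  shows "anorm A (a \<ominus>\<^bsub>A\<^esub> b) \<le> anorm A a + anorm A b"
proof -
  have "anorm A (\<ominus>\<^bsub>A\<^esub> b) = anorm A b"
    using smult_l_minus[of 1 b] smult_one[of b] anorm_smult[of b "-1"] assms by simp
  thus ?thesis
    using anorm_triangle[of a "\<ominus>\<^bsub>A\<^esub> b"] assms by (simp add: a_minus_def)
qed

lemma ring_if_unital: "monoid A \<Longrightarrow> ring A"
  by (rule ringI) (auto simp: M.abelian_group_axioms mult_add_left mult_add_right)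

lemma eq_if_anorm_minus_le_null_seq:
  assumes "a \<in> carrier A" "b \<in> carrier A"
    and "\<And>n. anorm A (a \<ominus>\<^bsub>A\<^esub> b) \<le> f n" "f \<longlonglongrightarrow> 0"
  shows "a = b"
proof -
  have "anorm A (a \<ominus>\<^bsub>A\<^esub> b) \<le> 0"
    by (rule LIMSEQ_le_const[OF assms(4)]) (use assms(3) in auto)
  hence "anorm A (a \<ominus>\<^bsub>A\<^esub> b) = 0"
    using anorm_nonneg[of "a \<ominus>\<^bsub>A\<^esub> b"] assms by simp
  hence "a \<ominus>\<^bsub>A\<^esub> b = \<zero>\<^bsub>A\<^esub>"
    using anorm_eq_0_iff assms by simp
  thus ?thesis using assms M.minus_equality[of a "\<ominus>\<^bsub>A\<^esub> b"] by (simp add: a_minus_def)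
qed

text \<open>The Neumann series, as the limit of the iterates of \<open>x \<mapsto> 1 + a x\<close>: once two iterates are
  compared after \<open>n\<close> further steps, their distance has shrunk by the factor \<open>\<parallel>a\<parallel>\<^sup>n\<close>.\<close>

lemma Units_one_minus:
  assumes mon: "monoid A" and a: "a \<in> carrier A" and small: "anorm A a < 1"
  shows "\<one>\<^bsub>A\<^esub> \<ominus>\<^bsub>A\<^esub> a \<in> Units A"
proof -
  interpret rg: ring A by (rule ring_if_unital[OF mon])
  define s where "s = rec_nat \<zero>\<^bsub>A\<^esub> (\<lambda>_ x. \<one>\<^bsub>A\<^esub> \<oplus>\<^bsub>A\<^esub> a \<otimes>\<^bsub>A\<^esub> x)"
  have s0: "s 0 = \<zero>\<^bsub>A\<^esub>" and sS: "\<And>n. s (Suc n) = \<one>\<^bsub>A\<^esub> \<oplus>\<^bsub>A\<^esub> a \<otimes>\<^bsub>A\<^esub> s n"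
    by (simp_all add: s_def)
  have s [simp]: "s n \<in> carrier A" for n
    by (induction n) (simp_all add: s0 sS a)
  define r where "r = anorm A a"
  define c where "c = anorm A \<one>\<^bsub>A\<^esub> / (1 - r)"
  have r: "0 \<le> r" "r < 1" using small anorm_nonneg a by (auto simp: r_def)
  have c: "0 \<le> c" unfolding c_def using r anorm_nonneg by simp
  have bound: "anorm A (s k) \<le> c" for k
  proof (induction k)
    case 0 thus ?case by (simp add: s0 c)
  next
    case (Suc k)
    have "anorm A (s (Suc k)) \<le> anorm A \<one>\<^bsub>A\<^esub> + anorm A (a \<otimes>\<^bsub>A\<^esub> s k)"
      unfolding sS using a by (intro anorm_triangle) auto
    also have "\<dots> \<le> anorm A \<one>\<^bsub>A\<^esub> + r * c"
      using anorm_mult[OF a s, of k] mult_left_mono[OF Suc r(1)] by (simp add: r_def)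
    also have "\<dots> = c" using r by (simp add: c_def field_simps)
    finally show ?case .
  qed
  have step: "(\<one>\<^bsub>A\<^esub> \<oplus>\<^bsub>A\<^esub> a \<otimes>\<^bsub>A\<^esub> x) \<ominus>\<^bsub>A\<^esub> (\<one>\<^bsub>A\<^esub> \<oplus>\<^bsub>A\<^esub> a \<otimes>\<^bsub>A\<^esub> y) = a \<otimes>\<^bsub>A\<^esub> (x \<ominus>\<^bsub>A\<^esub> y)"
    if "x \<in> carrier A" "y \<in> carrier A" for x y
    using that a
    by algebra
  have diff: "anorm A (s (n + k) \<ominus>\<^bsub>A\<^esub> s n) \<le> r ^ n * c" for n k
  proof (induction n)
    case 0 thus ?case using bound[of k] by (simp add: s0 a_minus_def)
  next
    case (Suc n)
    have "anorm A (s (Suc n + k) \<ominus>\<^bsub>A\<^esub> s (Suc n)) = anorm A (a \<otimes>\<^bsub>A\<^esub> (s (n + k) \<ominus>\<^bsub>A\<^esub> s n))"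
      by (simp add: sS step)
    also have "\<dots> \<le> r * anorm A (s (n + k) \<ominus>\<^bsub>A\<^esub> s n)"
      unfolding r_def using a by (intro anorm_mult) auto
    also have "\<dots> \<le> r ^ Suc n * c" using mult_left_mono[OF Suc r(1)] by (simp add: mult.assoc)
    finally show ?case .
  qed
  have rlim: "(\<lambda>n. r ^ n * c) \<longlonglongrightarrow> 0"
    using tendsto_mult_left_zero[OF LIMSEQ_realpow_zero[OF r]] .
  have "\<exists>l\<in>carrier A. (\<lambda>n. anorm A (s n \<ominus>\<^bsub>A\<^esub> l)) \<longlonglongrightarrow> 0"
  proof (rule complete)
    fix e :: real assume e: "e > 0"
    obtain M where M: "\<And>n. n \<ge> M \<Longrightarrow> r ^ n * c < e"
      using order_tendstoD(2)[OF rlim e] unfolding eventually_sequentially by blast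
    have "anorm A (s m \<ominus>\<^bsub>A\<^esub> s n) < e" if "m \<ge> M" "n \<ge> M" for m n
    proof (cases "n \<le> m")
      case True
      have "anorm A (s m \<ominus>\<^bsub>A\<^esub> s n) \<le> r ^ n * c" using diff[of n "m - n"] True by simp
      with M[OF that(2)] show ?thesis by simp
    next
      case False
      have "anorm A (s m \<ominus>\<^bsub>A\<^esub> s n) \<le> r ^ m * c"
        using diff[of m "n - m"] False anorm_minus_commute[of "s m" "s n"] by simp
      with M[OF that(1)] show ?thesis by simp
    qed
    thus "\<exists>M. \<forall>m\<ge>M. \<forall>n\<ge>M. anorm A (s m \<ominus>\<^bsub>A\<^esub> s n) < e" by blast
  qed simp
  then obtain l where l: "l \<in> carrier A" and lim: "(\<lambda>n. anorm A (s n \<ominus>\<^bsub>A\<^esub> l)) \<longlonglongrightarrow> 0" by blast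
  have fixpoint: "l = \<one>\<^bsub>A\<^esub> \<oplus>\<^bsub>A\<^esub> a \<otimes>\<^bsub>A\<^esub> l"
  proof (rule eq_if_anorm_minus_le_null_seq)
    fix n
    have "l \<ominus>\<^bsub>A\<^esub> (\<one>\<^bsub>A\<^esub> \<oplus>\<^bsub>A\<^esub> a \<otimes>\<^bsub>A\<^esub> l) =
        (s (Suc n) \<ominus>\<^bsub>A\<^esub> (\<one>\<^bsub>A\<^esub> \<oplus>\<^bsub>A\<^esub> a \<otimes>\<^bsub>A\<^esub> l)) \<ominus>\<^bsub>A\<^esub> (s (Suc n) \<ominus>\<^bsub>A\<^esub> l)"
      using l a s[of "Suc n"] by algebra
    also have "\<dots> = a \<otimes>\<^bsub>A\<^esub> (s n \<ominus>\<^bsub>A\<^esub> l) \<ominus>\<^bsub>A\<^esub> (s (Suc n) \<ominus>\<^bsub>A\<^esub> l)"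
      using step[of "s n" l] l by (simp add: sS)
    also have "anorm A \<dots> \<le> anorm A (a \<otimes>\<^bsub>A\<^esub> (s n \<ominus>\<^bsub>A\<^esub> l)) + anorm A (s (Suc n) \<ominus>\<^bsub>A\<^esub> l)"
      using a l by (intro anorm_minus_le) auto
    also have "\<dots> \<le> r * anorm A (s n \<ominus>\<^bsub>A\<^esub> l) + anorm A (s (Suc n) \<ominus>\<^bsub>A\<^esub> l)"
      unfolding r_def using a l by (intro add_right_mono anorm_mult) auto
    finally show "anorm A (l \<ominus>\<^bsub>A\<^esub> (\<one>\<^bsub>A\<^esub> \<oplus>\<^bsub>A\<^esub> a \<otimes>\<^bsub>A\<^esub> l)) \<le>
      r * anorm A (s n \<ominus>\<^bsub>A\<^esub> l) + anorm A (s (Suc n) \<ominus>\<^bsub>A\<^esub> l)" .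
  next
    show "(\<lambda>n. r * anorm A (s n \<ominus>\<^bsub>A\<^esub> l) + anorm A (s (Suc n) \<ominus>\<^bsub>A\<^esub> l)) \<longlonglongrightarrow> 0"
      using tendsto_add[OF tendsto_mult_right_zero[OF lim] LIMSEQ_Suc[OF lim]] by simp
  qed (use a l in auto)
  have scomm: "s n \<otimes>\<^bsub>A\<^esub> a = a \<otimes>\<^bsub>A\<^esub> s n" for n
    by (induction n) (simp_all add: s0 sS a rg.l_distr rg.r_distr rg.m_assoc)
  have comm: "l \<otimes>\<^bsub>A\<^esub> a = a \<otimes>\<^bsub>A\<^esub> l"
  proof (rule eq_if_anorm_minus_le_null_seq)
    fix n
    have "l \<otimes>\<^bsub>A\<^esub> a \<ominus>\<^bsub>A\<^esub> a \<otimes>\<^bsub>A\<^esub> l = a \<otimes>\<^bsub>A\<^esub> (s n \<ominus>\<^bsub>A\<^esub> l) \<ominus>\<^bsub>A\<^esub> (s n \<ominus>\<^bsub>A\<^esub> l) \<otimes>\<^bsub>A\<^esub> a"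
      using l a scomm[of n] s[of n] by algebra
    also have "anorm A \<dots> \<le> anorm A (a \<otimes>\<^bsub>A\<^esub> (s n \<ominus>\<^bsub>A\<^esub> l)) + anorm A ((s n \<ominus>\<^bsub>A\<^esub> l) \<otimes>\<^bsub>A\<^esub> a)"
      using a l by (intro anorm_minus_le) auto
    also have "\<dots> \<le> r * anorm A (s n \<ominus>\<^bsub>A\<^esub> l) + anorm A (s n \<ominus>\<^bsub>A\<^esub> l) * r"
      unfolding r_def using a l by (intro add_mono anorm_mult) auto
    finally show "anorm A (l \<otimes>\<^bsub>A\<^esub> a \<ominus>\<^bsub>A\<^esub> a \<otimes>\<^bsub>A\<^esub> l) \<le>
      r * anorm A (s n \<ominus>\<^bsub>A\<^esub> l) + anorm A (s n \<ominus>\<^bsub>A\<^esub> l) * r" .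
  next
    show "(\<lambda>n. r * anorm A (s n \<ominus>\<^bsub>A\<^esub> l) + anorm A (s n \<ominus>\<^bsub>A\<^esub> l) * r) \<longlonglongrightarrow> 0"
      by (auto intro!: tendsto_eq_intros lim)
  qed (use a l in auto)
  have one: "l \<ominus>\<^bsub>A\<^esub> a \<otimes>\<^bsub>A\<^esub> l = \<one>\<^bsub>A\<^esub>"
    using fixpoint a l by (metis M.add.inv_solve_right' rg.m_closed rg.one_closed M.minus_eq)
  have "(\<one>\<^bsub>A\<^esub> \<ominus>\<^bsub>A\<^esub> a) \<otimes>\<^bsub>A\<^esub> l = \<one>\<^bsub>A\<^esub>" "l \<otimes>\<^bsub>A\<^esub> (\<one>\<^bsub>A\<^esub> \<ominus>\<^bsub>A\<^esub> a) = \<one>\<^bsub>A\<^esub>"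
    using one a l comm by (simp_all add: a_minus_def rg.l_distr rg.r_distr rg.l_minus rg.r_minus)
  thus ?thesis using a l by (auto simp: Units_def)
qed

text \<open>Factor \<open>u - b = u (1 - u\<^sup>-\<^sup>1 b)\<close>. The admissible size of \<open>b\<close> depends on \<open>u\<close> through the
  norm of its inverse alone, so a bound on resolvents gives a radius that is uniform in the spectral
  parameter.\<close>

lemma Units_minus:
  assumes mon: "monoid A" and u: "u \<in> Units A" and b: "b \<in> carrier A"
    and small: "anorm A (inv\<^bsub>A\<^esub> u) * anorm A b < 1"
  shows "u \<ominus>\<^bsub>A\<^esub> b \<in> Units A"
proof -
  interpret rg: ring A by (rule ring_if_unital[OF mon])
  have uc: "u \<in> carrier A" and v: "inv\<^bsub>A\<^esub> u \<in> carrier A" using u by auto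
  have "anorm A (inv\<^bsub>A\<^esub> u \<otimes>\<^bsub>A\<^esub> b) < 1"
    using anorm_mult[OF v b] small by simp
  hence "\<one>\<^bsub>A\<^esub> \<ominus>\<^bsub>A\<^esub> inv\<^bsub>A\<^esub> u \<otimes>\<^bsub>A\<^esub> b \<in> Units A"
    using v b by (intro Units_one_minus[OF mon]) auto
  hence "u \<otimes>\<^bsub>A\<^esub> (\<one>\<^bsub>A\<^esub> \<ominus>\<^bsub>A\<^esub> inv\<^bsub>A\<^esub> u \<otimes>\<^bsub>A\<^esub> b) \<in> Units A" using u by simp
  also have "u \<otimes>\<^bsub>A\<^esub> (\<one>\<^bsub>A\<^esub> \<ominus>\<^bsub>A\<^esub> inv\<^bsub>A\<^esub> u \<otimes>\<^bsub>A\<^esub> b) = u \<ominus>\<^bsub>A\<^esub> b"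
    using u uc v b by (simp add: a_minus_def rg.r_distr rg.r_minus flip: rg.m_assoc)
  finally show ?thesis .
qed

lemma alg_infsum_eqI:
  assumes f: "\<And>i. f i \<in> carrier A" and s: "alg_has_sum A f s"
  shows "alg_infsum A f = s"
  unfolding alg_infsum_def
proof (rule the_equality)
  show "alg_has_sum A f s" by (rule s)
  fix t assume t: "alg_has_sum A f t"
  have c: "s \<in> carrier A" "t \<in> carrier A" using s t by (auto simp: alg_has_sum_def)
  let ?S = "finsum A f"
  have S: "?S F \<in> carrier A" for F using f by (intro M.finsum_closed) auto
  have lim: "((\<lambda>F. anorm A (?S F \<ominus>\<^bsub>A\<^esub> t) + anorm A (?S F \<ominus>\<^bsub>A\<^esub> s)) \<longlongrightarrow> 0 + 0)
      (finite_subsets_at_top UNIV)"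
    using s t unfolding alg_has_sum_def by (intro tendsto_add) auto
  have "anorm A (s \<ominus>\<^bsub>A\<^esub> t) \<le> anorm A (?S F \<ominus>\<^bsub>A\<^esub> t) + anorm A (?S F \<ominus>\<^bsub>A\<^esub> s)" for F
  proof -
    have "s \<ominus>\<^bsub>A\<^esub> t = (?S F \<ominus>\<^bsub>A\<^esub> t) \<ominus>\<^bsub>A\<^esub> (?S F \<ominus>\<^bsub>A\<^esub> s)"
      using c S[of F] by (simp add: a_minus_def M.minus_add M.a_ac M.r_neg M.r_neg1 M.r_neg2)
    thus ?thesis using anorm_minus_le[of "?S F \<ominus>\<^bsub>A\<^esub> t" "?S F \<ominus>\<^bsub>A\<^esub> s"] c S[of F] by simp
  qed
  hence "anorm A (s \<ominus>\<^bsub>A\<^esub> t) \<le> 0 + 0"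
    by (intro tendsto_lowerbound[OF lim] always_eventually) auto
  hence "anorm A (t \<ominus>\<^bsub>A\<^esub> s) \<le> 0" using anorm_minus_commute[of s t] c by simp
  thus "t = s" using c by (intro eq_if_anorm_minus_le_null_seq[where f = "\<lambda>_. 0"]) auto
qed

end

section \<open>Closed *-subalgebras of symmetric algebras\<close>

text \<open>\<open>T\<close> is a bare record here: that it is a Banach *-algebra is a consequence, since every algebraic
  identity and every norm inequality can be read off from \<open>D\<close> through the injection \<open>\<Phi>\<close>, and
  completeness is the closedness of the image.\<close>

locale isometric_star_embedding = target: symmetric_banach_star_algebra D
  for D :: "('d, 'm) star_algebra_scheme" +
  fixes T :: "('t, 'n) star_algebra_scheme" and \<Phi> :: "'t \<Rightarrow> 'd"
  assumes unital: "monoid D"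
    and emb_carrier: "a \<in> carrier T \<Longrightarrow> \<Phi> a \<in> carrier D"
    and emb_inj: "inj_on \<Phi> (carrier T)"
    and one_mem: "\<one>\<^bsub>T\<^esub> \<in> carrier T" and zero_mem: "\<zero>\<^bsub>T\<^esub> \<in> carrier T"
    and add_mem: "a \<in> carrier T \<Longrightarrow> b \<in> carrier T \<Longrightarrow> a \<oplus>\<^bsub>T\<^esub> b \<in> carrier T"
    and mult_mem: "a \<in> carrier T \<Longrightarrow> b \<in> carrier T \<Longrightarrow> a \<otimes>\<^bsub>T\<^esub> b \<in> carrier T"
    and smult_mem: "a \<in> carrier T \<Longrightarrow> z \<odot>\<^bsub>T\<^esub> a \<in> carrier T"
    and invol_mem: "a \<in> carrier T \<Longrightarrow> invol T a \<in> carrier T"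
    and emb_one: "\<Phi> \<one>\<^bsub>T\<^esub> = \<one>\<^bsub>D\<^esub>" and emb_zero: "\<Phi> \<zero>\<^bsub>T\<^esub> = \<zero>\<^bsub>D\<^esub>"
    and emb_add: "a \<in> carrier T \<Longrightarrow> b \<in> carrier T \<Longrightarrow> \<Phi> (a \<oplus>\<^bsub>T\<^esub> b) = \<Phi> a \<oplus>\<^bsub>D\<^esub> \<Phi> b"
    and emb_mult: "a \<in> carrier T \<Longrightarrow> b \<in> carrier T \<Longrightarrow> \<Phi> (a \<otimes>\<^bsub>T\<^esub> b) = \<Phi> a \<otimes>\<^bsub>D\<^esub> \<Phi> b"
    and emb_smult: "a \<in> carrier T \<Longrightarrow> \<Phi> (z \<odot>\<^bsub>T\<^esub> a) = z \<odot>\<^bsub>D\<^esub> \<Phi> a"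
    and emb_invol: "a \<in> carrier T \<Longrightarrow> \<Phi> (invol T a) = invol D (\<Phi> a)"
    and emb_anorm: "a \<in> carrier T \<Longrightarrow> anorm D (\<Phi> a) = anorm T a"
    and emb_closed: "(\<And>n :: nat. X n \<in> carrier T) \<Longrightarrow> l \<in> carrier D \<Longrightarrow>
      (\<lambda>n. anorm D (\<Phi> (X n) \<ominus>\<^bsub>D\<^esub> l)) \<longlonglongrightarrow> 0 \<Longrightarrow> l \<in> \<Phi> ` carrier T"
begin

lemma emb_eq_iff: "a \<in> carrier T \<Longrightarrow> b \<in> carrier T \<Longrightarrow> \<Phi> a = \<Phi> b \<longleftrightarrow> a = b"
  using emb_inj by (auto dest: inj_onD)

lemmas emb_simps = emb_one emb_zero emb_add emb_mult emb_smult emb_invol emb_anorm emb_carrier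
  one_mem zero_mem add_mem mult_mem smult_mem invol_mem

lemma ring_target: "ring D"
  by (rule target.ring_if_unital[OF unital])

lemma abelian_group_source: "abelian_group T"
proof (rule abelian_groupI)
  fix a assume a: "a \<in> carrier T"
  have "\<Phi> ((-1) \<odot>\<^bsub>T\<^esub> a \<oplus>\<^bsub>T\<^esub> a) = \<Phi> a \<ominus>\<^bsub>D\<^esub> \<Phi> a"
    using a by (simp add: emb_simps target.minus_eq_add_smult target.M.a_comm)
  also have "\<dots> = \<Phi> \<zero>\<^bsub>T\<^esub>"
    using a by (simp add: emb_simps a_minus_def target.M.r_neg)
  finally have "(-1) \<odot>\<^bsub>T\<^esub> a \<oplus>\<^bsub>T\<^esub> a = \<zero>\<^bsub>T\<^esub>"
    using a by (subst (asm) emb_eq_iff) (auto simp: emb_simps)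
  thus "\<exists>b\<in>carrier T. b \<oplus>\<^bsub>T\<^esub> a = \<zero>\<^bsub>T\<^esub>" using a by (auto simp: smult_mem)
next
  fix a b c assume "a \<in> carrier T" "b \<in> carrier T" "c \<in> carrier T"
  thus "a \<oplus>\<^bsub>T\<^esub> b \<oplus>\<^bsub>T\<^esub> c = a \<oplus>\<^bsub>T\<^esub> (b \<oplus>\<^bsub>T\<^esub> c)" "a \<oplus>\<^bsub>T\<^esub> b = b \<oplus>\<^bsub>T\<^esub> a" "\<zero>\<^bsub>T\<^esub> \<oplus>\<^bsub>T\<^esub> a = a"
    by (auto simp: emb_simps target.M.a_ac intro!: inj_onD[OF emb_inj])
qed (auto simp: add_mem zero_mem)

lemma module_source: "module complex_ring T"
proof (rule moduleI)
  fix a x y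
  assume "x \<in> carrier T" "y \<in> carrier T"
  thus "a \<odot>\<^bsub>T\<^esub> (x \<oplus>\<^bsub>T\<^esub> y) = a \<odot>\<^bsub>T\<^esub> x \<oplus>\<^bsub>T\<^esub> a \<odot>\<^bsub>T\<^esub> y"
    using target.smult_r_distr[of a "\<Phi> x" "\<Phi> y"] by (simp add: emb_simps flip: emb_eq_iff)
next
  fix a b x
  assume x: "x \<in> carrier T"
  show "(a \<oplus>\<^bsub>complex_ring\<^esub> b) \<odot>\<^bsub>T\<^esub> x = a \<odot>\<^bsub>T\<^esub> x \<oplus>\<^bsub>T\<^esub> b \<odot>\<^bsub>T\<^esub> x"
    using x target.smult_l_distr[of a b "\<Phi> x"] by (simp add: emb_simps flip: emb_eq_iff)
  show "(a \<otimes>\<^bsub>complex_ring\<^esub> b) \<odot>\<^bsub>T\<^esub> x = a \<odot>\<^bsub>T\<^esub> (b \<odot>\<^bsub>T\<^esub> x)"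
    using x target.smult_assoc1[of a b "\<Phi> x"] by (simp add: emb_simps flip: emb_eq_iff)
next
  fix x
  assume x: "x \<in> carrier T"
  show "\<one>\<^bsub>complex_ring\<^esub> \<odot>\<^bsub>T\<^esub> x = x"
    using x target.smult_one[of "\<Phi> x"] by (simp add: emb_simps flip: emb_eq_iff)
qed (auto intro: cring_complex_ring abelian_group_source smult_mem)

lemma emb_minus:
  assumes "a \<in> carrier T" "b \<in> carrier T"
  shows "a \<ominus>\<^bsub>T\<^esub> b \<in> carrier T" "\<Phi> (a \<ominus>\<^bsub>T\<^esub> b) = \<Phi> a \<ominus>\<^bsub>D\<^esub> \<Phi> b"
proof -
  interpret src: abelian_group T by (rule abelian_group_source)
  show *: "a \<ominus>\<^bsub>T\<^esub> b \<in> carrier T" using assms by simp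
  have "\<Phi> (a \<ominus>\<^bsub>T\<^esub> b) \<oplus>\<^bsub>D\<^esub> \<Phi> b = \<Phi> a"
    using assms * by (simp add: src.minus_eq src.a_assoc src.l_neg flip: emb_add)
  thus "\<Phi> (a \<ominus>\<^bsub>T\<^esub> b) = \<Phi> a \<ominus>\<^bsub>D\<^esub> \<Phi> b"
    using assms * by (metis emb_carrier target.M.add.inv_solve_right target.M.minus_eq target.M.a_closed)
qed

lemma monoid_source: "monoid T"
proof -
  interpret rg: ring D by (rule ring_target)
  show ?thesis
    by (rule monoidI) (auto simp: emb_simps rg.m_assoc simp flip: emb_eq_iff)
qed

lemma banach_star_algebra_source: "banach_star_algebra T"
proof -
  interpret rg: ring D by (rule ring_target)
  interpret src: module complex_ring T by (rule module_source)
  show ?thesis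
  proof
    fix u assume u: "u \<in> carrier T"
      and unit: "\<And>a. a \<in> carrier T \<Longrightarrow> u \<otimes>\<^bsub>T\<^esub> a = a \<and> a \<otimes>\<^bsub>T\<^esub> u = a"
    have "\<Phi> u = \<Phi> (u \<otimes>\<^bsub>T\<^esub> \<one>\<^bsub>T\<^esub>)" using u one_mem by (simp add: emb_simps)
    also have "\<dots> = \<Phi> \<one>\<^bsub>T\<^esub>" using unit[OF one_mem] by simp
    finally show "u = \<one>\<^bsub>T\<^esub>" using u one_mem by (simp add: emb_eq_iff)
  next
    fix X :: "nat \<Rightarrow> 't"
    assume X: "\<And>n. X n \<in> carrier T"
      and cauchy: "\<And>e. e > 0 \<Longrightarrow> \<exists>M. \<forall>m\<ge>M. \<forall>n\<ge>M. anorm T (X m \<ominus>\<^bsub>T\<^esub> X n) < e"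
    have norm_diff: "anorm D (\<Phi> a \<ominus>\<^bsub>D\<^esub> \<Phi> b) = anorm T (a \<ominus>\<^bsub>T\<^esub> b)"
      if "a \<in> carrier T" "b \<in> carrier T" for a b
      using emb_minus[OF that] emb_anorm by metis
    have "\<exists>l\<in>carrier D. (\<lambda>n. anorm D (\<Phi> (X n) \<ominus>\<^bsub>D\<^esub> l)) \<longlonglongrightarrow> 0"
      by (rule target.complete) (use X cauchy in \<open>simp_all add: emb_carrier norm_diff\<close>)
    then obtain l where l: "l \<in> carrier D" "(\<lambda>n. anorm D (\<Phi> (X n) \<ominus>\<^bsub>D\<^esub> l)) \<longlonglongrightarrow> 0" by blast
    then obtain a where "a \<in> carrier T" "l = \<Phi> a" using emb_closed[of X l] X by blast
    thus "\<exists>l\<in>carrier T. (\<lambda>n. anorm T (X n \<ominus>\<^bsub>T\<^esub> l)) \<longlonglongrightarrow> 0"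
      using l X by (auto simp: norm_diff)
  next
    fix a b assume "a \<in> carrier T" "b \<in> carrier T"
    thus "anorm T (a \<oplus>\<^bsub>T\<^esub> b) \<le> anorm T a + anorm T b"
      using target.anorm_triangle[of "\<Phi> a" "\<Phi> b"] by (simp add: emb_carrier flip: emb_anorm emb_add add: add_mem)
  next
    fix a b assume "a \<in> carrier T" "b \<in> carrier T"
    thus "anorm T (a \<otimes>\<^bsub>T\<^esub> b) \<le> anorm T a * anorm T b"
      using target.anorm_mult[of "\<Phi> a" "\<Phi> b"] by (simp add: emb_carrier flip: emb_anorm emb_mult add: mult_mem)
  next
    fix z a assume "a \<in> carrier T"
    thus "anorm T (z \<odot>\<^bsub>T\<^esub> a) = cmod z * anorm T a"
      using target.anorm_smult[of "\<Phi> a" z] by (simp add: emb_carrier flip: emb_anorm emb_smult add: smult_mem)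
  next
    fix a assume "a \<in> carrier T"
    thus "anorm T (invol T a) = anorm T a"
      using target.anorm_invol[of "\<Phi> a"] by (simp add: emb_carrier flip: emb_anorm emb_invol add: invol_mem)
  next
    fix a assume "a \<in> carrier T"
    thus "0 \<le> anorm T a" using target.anorm_nonneg[of "\<Phi> a"] by (simp add: emb_carrier flip: emb_anorm)
  next
    fix a assume "a \<in> carrier T"
    thus "anorm T a = 0 \<longleftrightarrow> a = \<zero>\<^bsub>T\<^esub>"
      using target.anorm_eq_0_iff[of "\<Phi> a"]
      using emb_eq_iff[of a "\<zero>\<^bsub>T\<^esub>"] by (simp add: emb_simps)
  next
    fix a b c assume "a \<in> carrier T" "b \<in> carrier T" "c \<in> carrier T"
    thus "(a \<otimes>\<^bsub>T\<^esub> b) \<otimes>\<^bsub>T\<^esub> c = a \<otimes>\<^bsub>T\<^esub> (b \<otimes>\<^bsub>T\<^esub> c)"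
      "(a \<oplus>\<^bsub>T\<^esub> b) \<otimes>\<^bsub>T\<^esub> c = a \<otimes>\<^bsub>T\<^esub> c \<oplus>\<^bsub>T\<^esub> b \<otimes>\<^bsub>T\<^esub> c"
      "a \<otimes>\<^bsub>T\<^esub> (b \<oplus>\<^bsub>T\<^esub> c) = a \<otimes>\<^bsub>T\<^esub> b \<oplus>\<^bsub>T\<^esub> a \<otimes>\<^bsub>T\<^esub> c"
      by (auto simp: emb_simps target.mult_assoc target.mult_add_left target.mult_add_right
          intro!: inj_onD[OF emb_inj])
  next
    fix z a b assume "a \<in> carrier T" "b \<in> carrier T"
    thus "(z \<odot>\<^bsub>T\<^esub> a) \<otimes>\<^bsub>T\<^esub> b = z \<odot>\<^bsub>T\<^esub> (a \<otimes>\<^bsub>T\<^esub> b)"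
      "a \<otimes>\<^bsub>T\<^esub> (z \<odot>\<^bsub>T\<^esub> b) = z \<odot>\<^bsub>T\<^esub> (a \<otimes>\<^bsub>T\<^esub> b)"
      "invol T (a \<oplus>\<^bsub>T\<^esub> b) = invol T a \<oplus>\<^bsub>T\<^esub> invol T b"
      "invol T (a \<otimes>\<^bsub>T\<^esub> b) = invol T b \<otimes>\<^bsub>T\<^esub> invol T a"
      by (auto simp: emb_simps target.mult_smult_left target.mult_smult_right target.invol_add
          target.invol_mult intro!: inj_onD[OF emb_inj])
  next
    fix z a assume "a \<in> carrier T"
    thus "invol T (invol T a) = a" "invol T (z \<odot>\<^bsub>T\<^esub> a) = cnj z \<odot>\<^bsub>T\<^esub> invol T a"
      by (auto simp: emb_simps target.invol_invol target.invol_smult intro!: inj_onD[OF emb_inj])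
  qed (auto simp: mult_mem invol_mem)
qed

lemma emb_Units:
  assumes "u \<in> Units T"
  shows "\<Phi> u \<in> Units D" "inv\<^bsub>D\<^esub> (\<Phi> u) = \<Phi> (inv\<^bsub>T\<^esub> u)"
proof -
  interpret src: monoid T by (rule monoid_source)
  interpret tgt: monoid D by (rule unital)
  have c: "u \<in> carrier T" "inv\<^bsub>T\<^esub> u \<in> carrier T" using assms by auto
  have eqs: "\<Phi> u \<otimes>\<^bsub>D\<^esub> \<Phi> (inv\<^bsub>T\<^esub> u) = \<one>\<^bsub>D\<^esub>" "\<Phi> (inv\<^bsub>T\<^esub> u) \<otimes>\<^bsub>D\<^esub> \<Phi> u = \<one>\<^bsub>D\<^esub>"
    using assms c by (simp_all flip: emb_mult emb_one)
  show "\<Phi> u \<in> Units D" unfolding Units_def using c eqs emb_carrier by auto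
  show "inv\<^bsub>D\<^esub> (\<Phi> u) = \<Phi> (inv\<^bsub>T\<^esub> u)"
    using tgt.inv_char[of "\<Phi> u" "\<Phi> (inv\<^bsub>T\<^esub> u)"] eqs c emb_carrier by simp
qed

text \<open>Spectral permanence: as \<open>z\<close> moves through a connected part of the resolvent set of \<open>\<Phi> b\<close>, the
  inverse of \<open>z - \<Phi> b\<close> cannot leave the image of \<open>\<Phi>\<close>. Near a given \<open>z\<close> the inverses in \<open>D\<close> are
  uniformly bounded, so by the Neumann series in \<open>T\<close>, whose radius depends only on the norm of
  the inverse, invertibility in \<open>T\<close> at one point of a small ball forces it on the whole ball. Hence
  the points where the inverse lies in \<open>T\<close> form a relatively open and closed set.\<close>

lemma Units_if_resolvent_connected:
  assumes b: "b \<in> carrier T" and W: "connected W" "z0 \<in> W"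
    and res: "\<And>z. z \<in> W \<Longrightarrow> (z \<odot>\<^bsub>D\<^esub> \<one>\<^bsub>D\<^esub>) \<ominus>\<^bsub>D\<^esub> \<Phi> b \<in> Units D"
    and start: "(z0 \<odot>\<^bsub>T\<^esub> \<one>\<^bsub>T\<^esub>) \<ominus>\<^bsub>T\<^esub> b \<in> Units T"
    and z: "z \<in> W"
  shows "(z \<odot>\<^bsub>T\<^esub> \<one>\<^bsub>T\<^esub>) \<ominus>\<^bsub>T\<^esub> b \<in> Units T"
proof -
  interpret tr: ring D by (rule ring_target)
  interpret src: banach_star_algebra T by (rule banach_star_algebra_source)
  interpret sr: ring T by (rule src.ring_if_unital[OF monoid_source])
  define res where "res z = (z \<odot>\<^bsub>T\<^esub> \<one>\<^bsub>T\<^esub>) \<ominus>\<^bsub>T\<^esub> b" for z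
  have res_carrier [simp]: "res z \<in> carrier T" for z
    using b by (simp add: res_def)
  have emb_res: "\<Phi> (res z) = (z \<odot>\<^bsub>D\<^esub> \<one>\<^bsub>D\<^esub>) \<ominus>\<^bsub>D\<^esub> \<Phi> b" for z
    using b by (simp add: res_def emb_minus emb_simps)
  have res_diff: "res z \<ominus>\<^bsub>T\<^esub> ((z - w) \<odot>\<^bsub>T\<^esub> \<one>\<^bsub>T\<^esub>) = res w" for z w
  proof -
    have "z \<odot>\<^bsub>T\<^esub> \<one>\<^bsub>T\<^esub> = (z - w) \<odot>\<^bsub>T\<^esub> \<one>\<^bsub>T\<^esub> \<oplus>\<^bsub>T\<^esub> w \<odot>\<^bsub>T\<^esub> \<one>\<^bsub>T\<^esub>"
      using src.smult_l_distr[of "z - w" w "\<one>\<^bsub>T\<^esub>"] by simp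
    thus ?thesis unfolding res_def using b
      by (simp add: src.M.minus_eq src.M.a_ac src.M.r_neg src.M.r_neg1 src.M.r_neg2)
  qed
  define c where "c = anorm T \<one>\<^bsub>T\<^esub>"
  have c: "c \<ge> 0" by (simp add: c_def src.anorm_nonneg)
  have move: "res w \<in> Units T"
    if "res z \<in> Units T" "anorm T (inv\<^bsub>T\<^esub> (res z)) * (cmod (z - w) * c) < 1" for z w
    using src.Units_minus[OF monoid_source that(1), of "(z - w) \<odot>\<^bsub>T\<^esub> \<one>\<^bsub>T\<^esub>"] that(2)
    by (simp add: res_diff src.anorm_smult c_def)
  have "res z \<in> Units T \<longleftrightarrow> res z0 \<in> Units T"
  proof (rule connected_equivalence_relation[OF W(1) z W(2), where
        R = "\<lambda>x y. res x \<in> Units T \<longleftrightarrow> res y \<in> Units T"])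
    fix z assume z: "z \<in> W"
    define r where "r = inv\<^bsub>D\<^esub> (\<Phi> (res z))"
    have u: "\<Phi> (res z) \<in> Units D" using res[OF z] by (simp add: emb_res)
    have rc: "r \<in> carrier D" unfolding r_def using u by simp
    define \<rho> where "\<rho> = anorm D r"
    have \<rho>: "\<rho> \<ge> 0" unfolding \<rho>_def by (rule target.anorm_nonneg[OF rc])
    \<comment> \<open>Small enough that a step of length \<open>\<delta>\<close> stays inside the Neumann radius for every inverse of
      norm at most \<open>2 \<rho>\<close>; the added ones avoid division by zero.\<close>
    define \<delta> where "\<delta> = 1 / (4 * (\<rho> + 1) * (c + 1))"
    have \<delta>: "\<delta> > 0" unfolding \<delta>_def using \<rho> c by simp
    have small: "\<rho> * (d * c) \<le> 1/4" if "0 \<le> d" "d \<le> \<delta>" for d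
    proof -
      have "\<rho> * (d * c) \<le> (\<rho> + 1) * (\<delta> * (c + 1))"
        using that \<rho> c by (intro mult_mono) auto
      also have "\<dots> = 1/4" using \<rho> c by (simp add: \<delta>_def)
      finally show ?thesis .
    qed
    have "res w \<in> Units T \<longleftrightarrow> res z \<in> Units T" if w: "w \<in> W" "dist z w < \<delta>" for w
    proof
      assume "res z \<in> Units T"
      moreover from this have "anorm T (inv\<^bsub>T\<^esub> (res z)) = \<rho>"
        by (simp add: \<rho>_def r_def emb_Units emb_anorm sr.Units_inv_closed)
      ultimately show "res w \<in> Units T"
        using small[of "cmod (z - w)"] w(2) by (intro move[of z w]) (auto simp: dist_norm)
    next
      assume uw: "res w \<in> Units T"
      define r' where "r' = inv\<^bsub>T\<^esub> (res w)"
      have r'c: "r' \<in> carrier T" unfolding r'_def using uw by simp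
      have r': "\<Phi> r' \<otimes>\<^bsub>D\<^esub> \<Phi> (res w) = \<one>\<^bsub>D\<^esub>"
        unfolding r'_def using uw by (simp flip: emb_mult emb_one)
      have rr: "\<Phi> (res z) \<otimes>\<^bsub>D\<^esub> r = \<one>\<^bsub>D\<^esub>" unfolding r_def using u by simp
      define t where "t = (z - w) \<odot>\<^bsub>T\<^esub> \<one>\<^bsub>T\<^esub>"
      have tc: "t \<in> carrier T" by (simp add: t_def)
      \<comment> \<open>The resolvent identity bounds the inverse at \<open>w\<close> by twice the inverse at \<open>z\<close>.\<close>
      have "\<Phi> (res w) = \<Phi> (res z) \<ominus>\<^bsub>D\<^esub> \<Phi> t"
        using res_diff[of z w] tc emb_minus(2)[of "res z" t] by (simp add: t_def)
      hence zw: "\<Phi> (res z) = \<Phi> (res w) \<oplus>\<^bsub>D\<^esub> \<Phi> t"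
        using tc by (simp add: target.M.minus_eq target.M.a_assoc target.M.l_neg emb_carrier)
      have "\<Phi> r' = \<Phi> r' \<otimes>\<^bsub>D\<^esub> (\<Phi> (res z) \<otimes>\<^bsub>D\<^esub> r)"
        using r'c by (simp add: rr emb_carrier)
      also have "\<dots> = (\<Phi> r' \<otimes>\<^bsub>D\<^esub> \<Phi> (res w)) \<otimes>\<^bsub>D\<^esub> r \<oplus>\<^bsub>D\<^esub> (\<Phi> r' \<otimes>\<^bsub>D\<^esub> \<Phi> t) \<otimes>\<^bsub>D\<^esub> r"
        unfolding zw using r'c rc tc by (simp add: tr.r_distr tr.l_distr tr.m_assoc emb_carrier)
      also have "\<dots> = r \<oplus>\<^bsub>D\<^esub> (\<Phi> r' \<otimes>\<^bsub>D\<^esub> \<Phi> t) \<otimes>\<^bsub>D\<^esub> r"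
        unfolding r' using rc by simp
      finally have "anorm D (\<Phi> r') \<le> \<rho> + anorm D ((\<Phi> r' \<otimes>\<^bsub>D\<^esub> \<Phi> t) \<otimes>\<^bsub>D\<^esub> r)"
        using target.anorm_triangle[of r "(\<Phi> r' \<otimes>\<^bsub>D\<^esub> \<Phi> t) \<otimes>\<^bsub>D\<^esub> r"] rc r'c tc
        by (simp add: \<rho>_def emb_carrier)
      also have "anorm D ((\<Phi> r' \<otimes>\<^bsub>D\<^esub> \<Phi> t) \<otimes>\<^bsub>D\<^esub> r) \<le> anorm D (\<Phi> r' \<otimes>\<^bsub>D\<^esub> \<Phi> t) * \<rho>"
        unfolding \<rho>_def using rc r'c tc by (intro target.anorm_mult) (auto simp: emb_carrier)
      also have "anorm D (\<Phi> r' \<otimes>\<^bsub>D\<^esub> \<Phi> t) * \<rho> \<le> (anorm D (\<Phi> r') * anorm D (\<Phi> t)) * \<rho>"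
        using r'c tc \<rho> by (intro mult_right_mono target.anorm_mult) (auto simp: emb_carrier)
      also have "anorm D (\<Phi> t) = cmod (z - w) * c"
        using tc by (simp add: emb_anorm) (simp add: t_def src.anorm_smult c_def)
      finally have "anorm T r' \<le> \<rho> + anorm T r' * (\<rho> * (cmod (z - w) * c))"
        using r'c by (simp add: emb_anorm mult_ac)
      also have "\<dots> \<le> \<rho> + anorm T r' * (1/4)"
        using small[of "cmod (z - w)"] w(2) src.anorm_nonneg[OF r'c]
        by (intro add_left_mono mult_left_mono) (auto simp: dist_norm)
      finally have "anorm T r' \<le> 2 * \<rho>" using \<rho> by simp
      hence "anorm T r' * (cmod (w - z) * c) \<le> 2 * \<rho> * (cmod (w - z) * c)"
        using c by (intro mult_right_mono) auto
      also have "\<dots> < 1"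
        using small[of "cmod (w - z)"] w(2) by (simp add: dist_norm norm_minus_commute)
      finally show "res z \<in> Units T"
        using uw by (intro move[of w z]) (auto simp: r'_def)
    qed
    hence "\<forall>w\<in>W \<inter> ball z \<delta>. res z \<in> Units T \<longleftrightarrow> res w \<in> Units T" by simp
    moreover have "openin (top_of_set W) (W \<inter> ball z \<delta>)" "z \<in> W \<inter> ball z \<delta>"
      using z \<delta> by (auto simp: openin_open_Int)
    ultimately show "\<exists>V. openin (top_of_set W) V \<and> z \<in> V \<and>
        (\<forall>w\<in>V. res z \<in> Units T \<longleftrightarrow> res w \<in> Units T)"
      by (intro exI[of _ "W \<inter> ball z \<delta>"] conjI)
  qed simp_all
  with start show ?thesis by (simp add: res_def)
qed

text \<open>Symmetry of \<open>D\<close> puts the complement of the nonnegative half-line into the resolvent set of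
  \<open>\<Phi> (b\<^sup>* b)\<close>. This slit plane is star-shaped about \<open>-1\<close>, hence connected, and it contains numbers of
  modulus larger than the norm, where the inverse is a Neumann series in \<open>T\<close>. So spectral
  permanence applies to all of it.\<close>

lemma symmetric_source: "symmetric_banach_star_algebra T"
proof -
  interpret src: banach_star_algebra T by (rule banach_star_algebra_source)
  interpret sr: ring T by (rule src.ring_if_unital[OF monoid_source])
  show ?thesis
  proof (unfold_locales, rule subsetI)
    fix a z assume a: "a \<in> carrier T" and sp: "z \<in> Defs.spectrum T (invol T a \<otimes>\<^bsub>T\<^esub> a)"
    define b where "b = invol T a \<otimes>\<^bsub>T\<^esub> a"
    have b: "b \<in> carrier T" using a by (simp add: b_def emb_simps)
    have emb_b: "\<Phi> b = invol D (\<Phi> a) \<otimes>\<^bsub>D\<^esub> \<Phi> a" using a by (simp add: b_def emb_simps)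
    define W :: "complex set" where "W = - \<real>\<^sub>\<ge>\<^sub>0"
    define m where "m = anorm T b + 1"
    have m: "m > 0" using src.anorm_nonneg[OF b] by (simp add: m_def)
    have res: "(w \<odot>\<^bsub>D\<^esub> \<one>\<^bsub>D\<^esub>) \<ominus>\<^bsub>D\<^esub> \<Phi> b \<in> Units D" if "w \<in> W" for w
      using target.spectrum_nonneg[OF emb_carrier[OF a]] that
      unfolding W_def spectrum_def spectrum_unital_def emb_b by (auto simp: unital)
    have "starlike W"
      unfolding starlike_def
    proof (intro bexI ballI subsetI)
      show "-1 \<in> W" by (simp add: W_def complex_nonneg_Reals_iff)
      fix w x assume w: "w \<in> W" and x: "x \<in> closed_segment (- 1) w"
      then obtain u where u: "0 \<le> u" "u \<le> 1" "x = (1 - u) *\<^sub>R (-1) + u *\<^sub>R w"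
        by (auto simp: closed_segment_def)
      have ReIm: "Re x = u * Re w - (1 - u)" "Im x = u * Im w"
        unfolding u(3) by (simp_all add: algebra_simps)
      show "x \<in> W"
      proof (rule ccontr)
        assume "x \<notin> W"
        hence x: "Im x = 0" "Re x \<ge> 0" by (auto simp: W_def complex_nonneg_Reals_iff)
        have "u \<noteq> 0" using x ReIm by auto
        hence "Im w = 0" "u * Re w \<ge> 0" using x ReIm u by auto
        hence "w \<notin> W" using \<open>u \<noteq> 0\<close> u(1) by (auto simp: W_def complex_nonneg_Reals_iff zero_le_mult_iff)
        with w show False by simp
      qed
    qed
    hence conn: "connected W" by (rule starlike_imp_connected)
    have start: "(complex_of_real (-m) \<odot>\<^bsub>T\<^esub> \<one>\<^bsub>T\<^esub>) \<ominus>\<^bsub>T\<^esub> b \<in> Units T"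
    proof -
      define s where "s = complex_of_real (-m)"
      define t where "t = inverse s"
      have s: "s \<noteq> 0" "s * t = 1" using m by (auto simp: s_def t_def)
      have "anorm T (t \<odot>\<^bsub>T\<^esub> b) < 1"
        using b m by (simp add: src.anorm_smult t_def s_def norm_inverse) (simp add: m_def field_simps)
      hence "\<one>\<^bsub>T\<^esub> \<ominus>\<^bsub>T\<^esub> t \<odot>\<^bsub>T\<^esub> b \<in> Units T"
        using b by (intro src.Units_one_minus[OF monoid_source]) auto
      moreover have "s \<odot>\<^bsub>T\<^esub> \<one>\<^bsub>T\<^esub> \<in> Units T"
        unfolding Units_def using s src.smult_assoc1[of s t "\<one>\<^bsub>T\<^esub>"] src.smult_assoc1[of t s "\<one>\<^bsub>T\<^esub>"]
          src.smult_one[of "\<one>\<^bsub>T\<^esub>"]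
        by (auto simp: src.mult_smult_left src.mult_smult_right mult.commute intro!: bexI[of _ "t \<odot>\<^bsub>T\<^esub> \<one>\<^bsub>T\<^esub>"])
      ultimately have "(s \<odot>\<^bsub>T\<^esub> \<one>\<^bsub>T\<^esub>) \<otimes>\<^bsub>T\<^esub> (\<one>\<^bsub>T\<^esub> \<ominus>\<^bsub>T\<^esub> t \<odot>\<^bsub>T\<^esub> b) \<in> Units T"
        by simp
      also have "(s \<odot>\<^bsub>T\<^esub> \<one>\<^bsub>T\<^esub>) \<otimes>\<^bsub>T\<^esub> (\<one>\<^bsub>T\<^esub> \<ominus>\<^bsub>T\<^esub> t \<odot>\<^bsub>T\<^esub> b) = s \<odot>\<^bsub>T\<^esub> \<one>\<^bsub>T\<^esub> \<ominus>\<^bsub>T\<^esub> b"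
        using s b src.smult_assoc1[of s t b] src.smult_one[of b]
        by (simp add: src.minus_eq_add_smult sr.r_distr src.mult_smult_left src.mult_smult_right)
          (simp add: mult.commute flip: src.smult_assoc1)
      finally show ?thesis by (simp add: s_def)
    qed
    have mW: "complex_of_real (-m) \<in> W" using m by (auto simp: W_def complex_nonneg_Reals_iff)
    have "(z \<odot>\<^bsub>T\<^esub> \<one>\<^bsub>T\<^esub>) \<ominus>\<^bsub>T\<^esub> b \<in> Units T" if "z \<in> W"
      using Units_if_resolvent_connected[OF b conn mW res start that] .
    moreover have "(z \<odot>\<^bsub>T\<^esub> \<one>\<^bsub>T\<^esub>) \<ominus>\<^bsub>T\<^esub> b \<notin> Units T"
      using sp by (simp add: b_def spectrum_def spectrum_unital_def monoid_source)
    ultimately show "z \<in> \<real>\<^sub>\<ge>\<^sub>0" by (auto simp: W_def)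
  qed
qed

end

section \<open>Infinite matrices acting boundedly on square-summable families\<close>

text \<open>\<open>mat_bound K C\<close> says that \<open>K\<close> is the matrix of an operator of norm at most \<open>C\<close> on \<open>\<ell>\<^sup>2\<close>. It is
  expressed by finite blocks only, so that it passes to adjoints by finite duality and to entrywise
  limits for free.\<close>

definition mat_bound :: "('a \<Rightarrow> 'a \<Rightarrow> complex) \<Rightarrow> real \<Rightarrow> bool" where
  "mat_bound K C \<longleftrightarrow> 0 \<le> C \<and> (\<forall>F E u. finite F \<longrightarrow> finite E \<longrightarrow>
     L2_set (\<lambda>x. cmod (\<Sum>y\<in>E. K x y * u y)) F \<le> C * L2_set (\<lambda>y. cmod (u y)) E)"

definition l2_bound :: "('a \<Rightarrow> complex) \<Rightarrow> real \<Rightarrow> bool" where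
  "l2_bound u c \<longleftrightarrow> 0 \<le> c \<and> (\<forall>F. finite F \<longrightarrow> L2_set (\<lambda>x. cmod (u x)) F \<le> c)"

definition mat_mult :: "('a \<Rightarrow> 'a \<Rightarrow> complex) \<Rightarrow> ('a \<Rightarrow> 'a \<Rightarrow> complex) \<Rightarrow> 'a \<Rightarrow> 'a \<Rightarrow> complex" where
  "mat_mult K M = (\<lambda>x y. \<Sum>\<^sub>\<infinity>z. K x z * M z y)"

lemma mat_boundI:
  assumes "0 \<le> C" "\<And>F E u. finite F \<Longrightarrow> finite E \<Longrightarrow>
    L2_set (\<lambda>x. cmod (\<Sum>y\<in>E. K x y * u y)) F \<le> C * L2_set (\<lambda>y. cmod (u y)) E"
  shows "mat_bound K C"
  using assms by (simp add: mat_bound_def)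

lemma mat_boundD:
  assumes "mat_bound K C" "finite F" "finite E"
  shows "L2_set (\<lambda>x. cmod (\<Sum>y\<in>E. K x y * u y)) F \<le> C * L2_set (\<lambda>y. cmod (u y)) E"
  using assms by (simp add: mat_bound_def)

lemma mat_bound_nonneg: "mat_bound K C \<Longrightarrow> 0 \<le> C"
  by (simp add: mat_bound_def)

lemma l2_bound_nonneg: "l2_bound u c \<Longrightarrow> 0 \<le> c"
  by (simp add: l2_bound_def)

lemma l2_boundD: "l2_bound u c \<Longrightarrow> finite F \<Longrightarrow> L2_set (\<lambda>x. cmod (u x)) F \<le> c"
  by (simp add: l2_bound_def)

lemma mat_bound_add:
  assumes "mat_bound K C" "mat_bound M D"
  shows "mat_bound (\<lambda>x y. K x y + M x y) (C + D)"
proof (rule mat_boundI)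
  show "0 \<le> C + D" using assms[THEN mat_bound_nonneg] by simp
next
  fix F E :: "'a set" and u :: "'a \<Rightarrow> complex" assume fin: "finite F" "finite E"
  have "L2_set (\<lambda>x. cmod (\<Sum>y\<in>E. (K x y + M x y) * u y)) F
      \<le> L2_set (\<lambda>x. cmod (\<Sum>y\<in>E. K x y * u y) + cmod (\<Sum>y\<in>E. M x y * u y)) F"
    by (rule L2_set_mono) (auto simp: distrib_right sum.distrib norm_triangle_ineq)
  also have "\<dots> \<le> L2_set (\<lambda>x. cmod (\<Sum>y\<in>E. K x y * u y)) F + L2_set (\<lambda>x. cmod (\<Sum>y\<in>E. M x y * u y)) F"
    by (rule L2_set_triangle_ineq)
  also have "\<dots> \<le> (C + D) * L2_set (\<lambda>y. cmod (u y)) E"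
    using mat_boundD[OF assms(1) fin, of u] mat_boundD[OF assms(2) fin, of u]
    by (simp add: distrib_right)
  finally show "L2_set (\<lambda>x. cmod (\<Sum>y\<in>E. (K x y + M x y) * u y)) F \<le> (C + D) * L2_set (\<lambda>y. cmod (u y)) E" .
qed

lemma mat_bound_smult:
  assumes "mat_bound K C"
  shows "mat_bound (\<lambda>x y. c * K x y) (cmod c * C)"
proof (rule mat_boundI)
  show "0 \<le> cmod c * C" using mat_bound_nonneg[OF assms] by simp
next
  fix F E :: "'a set" and u :: "'a \<Rightarrow> complex" assume fin: "finite F" "finite E"
  have "L2_set (\<lambda>x. cmod (\<Sum>y\<in>E. c * K x y * u y)) F = cmod c * L2_set (\<lambda>x. cmod (\<Sum>y\<in>E. K x y * u y)) F"
    by (simp add: L2_set_right_distrib norm_mult flip: sum_distrib_left mult.assoc) (simp add: mult.assoc norm_mult flip: sum_distrib_left)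
  also have "\<dots> \<le> cmod c * (C * L2_set (\<lambda>y. cmod (u y)) E)"
    by (intro mult_left_mono mat_boundD assms fin) simp
  finally show "L2_set (\<lambda>x. cmod (\<Sum>y\<in>E. c * K x y * u y)) F \<le> cmod c * C * L2_set (\<lambda>y. cmod (u y)) E"
    by (simp add: mult.assoc)
qed

lemma mat_bound_zero: "mat_bound (\<lambda>x y. 0) 0"
  by (rule mat_boundI) (auto simp: L2_set_def)

lemma cmod_entry_le: 
  assumes "mat_bound K C" shows "cmod (K x y) \<le> C"
  using mat_boundD[OF assms, of "{x}" "{y}" "\<lambda>_. 1"] by (simp add: L2_set_def)

text \<open>For \<open>w = K\<^sup>* v\<close> on a finite block, \<open>\<parallel>w\<parallel>\<^sup>2 = \<langle>v, K w\<rangle> \<le> \<parallel>v\<parallel> C \<parallel>w\<parallel>\<close>.\<close>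

lemma mat_bound_adjoint:
  assumes K: "mat_bound K C"
  shows "mat_bound (\<lambda>y x. cnj (K x y)) C"
proof (rule mat_boundI)
  show "0 \<le> C" by (rule mat_bound_nonneg[OF K])
next
  fix E F :: "'a set" and v :: "'a \<Rightarrow> complex" assume fin: "finite E" "finite F"
  define w where "w y = (\<Sum>x\<in>F. cnj (K x y) * v x)" for y
  define a where "a = L2_set (\<lambda>y. cmod (w y)) E"
  define b where "b = L2_set (\<lambda>x. cmod (v x)) F"
  have "complex_of_real (a ^ 2) = (\<Sum>y\<in>E. cnj (w y) * w y)"
    unfolding a_def L2_set_def
    by (simp add: sum_nonneg complex_norm_square mult.commute del: of_real_power)
  also have "\<dots> = (\<Sum>y\<in>E. \<Sum>x\<in>F. cnj (w y) * (cnj (K x y) * v x))"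
    by (simp add: w_def sum_distrib_left)
  also have "\<dots> = (\<Sum>x\<in>F. v x * cnj (\<Sum>y\<in>E. K x y * w y))"
    by (subst sum.swap) (simp add: sum_distrib_left mult_ac)
  finally have "a ^ 2 = cmod (\<Sum>x\<in>F. v x * cnj (\<Sum>y\<in>E. K x y * w y))"
    by (metis abs_power2 norm_of_real)
  also have "\<dots> \<le> (\<Sum>x\<in>F. \<bar>cmod (v x)\<bar> * \<bar>cmod (\<Sum>y\<in>E. K x y * w y)\<bar>)"
    by (rule order_trans[OF norm_sum]) (simp add: norm_mult del: cnj_sum)
  also have "\<dots> \<le> b * L2_set (\<lambda>x. cmod (\<Sum>y\<in>E. K x y * w y)) F"
    unfolding b_def by (rule L2_set_mult_ineq)
  also have "\<dots> \<le> b * (C * a)"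
    unfolding a_def b_def by (intro mult_left_mono mat_boundD[OF K] fin L2_set_nonneg)
  finally have "a * a \<le> (C * b) * a" by (simp add: power2_eq_square mult_ac)
  moreover have "a \<ge> 0" "b \<ge> 0" unfolding a_def b_def by (rule L2_set_nonneg)+
  ultimately have "a \<le> C * b"
    using mat_bound_nonneg[OF K] by (cases "a = 0") (auto simp: mult_le_cancel_right)
  thus "L2_set (\<lambda>y. cmod (\<Sum>x\<in>F. cnj (K x y) * v x)) E \<le> C * L2_set (\<lambda>x. cmod (v x)) F"
    by (simp add: a_def b_def w_def)
qed

lemma mat_bound_cnj:
  assumes K: "mat_bound K C"
  shows "mat_bound (\<lambda>x y. cnj (K x y)) C"
proof (rule mat_boundI)
  show "0 \<le> C" by (rule mat_bound_nonneg[OF K])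
next
  fix F E :: "'a set" and u :: "'a \<Rightarrow> complex" assume fin: "finite F" "finite E"
  have "cmod (\<Sum>y\<in>E. cnj (K x y) * u y) = cmod (\<Sum>y\<in>E. K x y * cnj (u y))" for x
    by (subst complex_mod_cnj[symmetric]) simp
  thus "L2_set (\<lambda>x. cmod (\<Sum>y\<in>E. cnj (K x y) * u y)) F \<le> C * L2_set (\<lambda>y. cmod (u y)) E"
    using mat_boundD[OF K fin, of "\<lambda>y. cnj (u y)"] by simp
qed

lemma mat_bound_transpose: "mat_bound K C \<Longrightarrow> mat_bound (\<lambda>y x. K x y) C"
  using mat_bound_cnj[OF mat_bound_adjoint] by simp

lemma mat_bound_tendsto:
  fixes K :: "'a \<Rightarrow> 'a \<Rightarrow> complex" and X :: "'i \<Rightarrow> 'a \<Rightarrow> 'a \<Rightarrow> complex"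
  assumes "\<And>x y. ((\<lambda>n. X n x y) \<longlongrightarrow> K x y) \<F>" "eventually (\<lambda>n. mat_bound (X n) C) \<F>" "\<F> \<noteq> bot"
  shows "mat_bound K C"
proof (rule mat_boundI)
  show "0 \<le> C"
    using eventually_happens[OF assms(2)] assms(3) mat_bound_nonneg by blast
next
  fix F E :: "'a set" and u :: "'a \<Rightarrow> complex" assume fin: "finite F" "finite E"
  have "((\<lambda>n. L2_set (\<lambda>x. cmod (\<Sum>y\<in>E. X n x y * u y)) F) \<longlongrightarrow>
      L2_set (\<lambda>x. cmod (\<Sum>y\<in>E. K x y * u y)) F) \<F>"
    unfolding L2_set_def by (intro tendsto_intros assms(1))
  moreover have "eventually (\<lambda>n. L2_set (\<lambda>x. cmod (\<Sum>y\<in>E. X n x y * u y)) F \<le>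
      C * L2_set (\<lambda>y. cmod (u y)) E) \<F>"
    using assms(2) by eventually_elim (rule mat_boundD[OF _ fin])
  ultimately show "L2_set (\<lambda>x. cmod (\<Sum>y\<in>E. K x y * u y)) F \<le> C * L2_set (\<lambda>y. cmod (u y)) E"
    by (rule tendsto_upperbound[OF _ _ assms(3)])
qed

lemma l2_bound_column: "mat_bound K C \<Longrightarrow> l2_bound (\<lambda>x. K x y) C"
  using mat_boundD[where u = "\<lambda>_. 1" and E = "{y}"]
  by (fastforce simp: l2_bound_def mat_bound_nonneg L2_set_def)

lemma l2_bound_row: "mat_bound K C \<Longrightarrow> l2_bound (K x) C"
  by (rule l2_bound_column[OF mat_bound_transpose])

lemma infsum_sum:
  fixes f :: "'a \<Rightarrow> 'b \<Rightarrow> complex"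
  assumes "\<And>y. y \<in> E \<Longrightarrow> (\<lambda>x. f x y) summable_on A"
  shows "(\<Sum>\<^sub>\<infinity>x\<in>A. \<Sum>y\<in>E. f x y) = (\<Sum>y\<in>E. \<Sum>\<^sub>\<infinity>x\<in>A. f x y)"
proof -
  have "((\<lambda>x. \<Sum>y\<in>E. f x y) has_sum (\<Sum>y\<in>E. \<Sum>\<^sub>\<infinity>x\<in>A. f x y)) A"
    using assms by (induction E rule: infinite_finite_induct) (simp_all add: has_sum_add)
  thus ?thesis by (rule infsumI)
qed

lemma
  assumes u: "l2_bound u c" and v: "l2_bound v d"
  shows abs_summable_l2_mult: "(\<lambda>z. cmod (u z * v z)) summable_on UNIV"
    and cmod_infsum_l2_mult_le: "cmod (\<Sum>\<^sub>\<infinity>z. u z * v z) \<le> c * d"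
proof -
  have fin: "(\<Sum>z\<in>F. cmod (u z * v z)) \<le> c * d" if "finite F" for F
  proof -
    have "(\<Sum>z\<in>F. cmod (u z * v z)) \<le> L2_set (\<lambda>x. cmod (u x)) F * L2_set (\<lambda>x. cmod (v x)) F"
      using L2_set_mult_ineq[of "\<lambda>x. cmod (u x)" "\<lambda>x. cmod (v x)" F] by (simp add: norm_mult)
    also have "\<dots> \<le> c * d"
      by (intro mult_mono l2_boundD[OF u] l2_boundD[OF v] that L2_set_nonneg l2_bound_nonneg[OF u])
    finally show ?thesis .
  qed
  show sm: "(\<lambda>z. cmod (u z * v z)) summable_on UNIV"
    by (rule nonneg_bdd_above_summable_on) (use fin in \<open>auto intro!: bdd_aboveI\<close>)
  have "cmod (\<Sum>\<^sub>\<infinity>z. u z * v z) \<le> (\<Sum>\<^sub>\<infinity>z. cmod (u z * v z))"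
    by (rule norm_infsum_bound[OF sm])
  also have "\<dots> \<le> c * d"
    by (rule infsum_le_finite_sums[OF sm]) (use fin in auto)
  finally show "cmod (\<Sum>\<^sub>\<infinity>z. u z * v z) \<le> c * d" .
qed

lemmas summable_l2_mult = abs_summable_summable[OF abs_summable_l2_mult]

lemma l2_bound_finite_vec:
  assumes "mat_bound K C" "finite E"
  shows "l2_bound (\<lambda>x. \<Sum>y\<in>E. K x y * u y) (C * L2_set (\<lambda>y. cmod (u y)) E)"
  using assms mat_bound_nonneg[OF assms(1)]
  by (auto simp: l2_bound_def intro: mat_boundD)

lemma l2_bound_mat_vec:
  assumes K: "mat_bound K C" and u: "l2_bound u c"
  shows "l2_bound (\<lambda>x. \<Sum>\<^sub>\<infinity>y. K x y * u y) (C * c)"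
  unfolding l2_bound_def
proof (intro conjI allI impI)
  show "0 \<le> C * c" using mat_bound_nonneg[OF K] l2_bound_nonneg[OF u] by simp
  fix F :: "'a set" assume F: "finite F"
  have lim: "((\<lambda>Y. L2_set (\<lambda>x. cmod (\<Sum>y\<in>Y. K x y * u y)) F) \<longlongrightarrow>
      L2_set (\<lambda>x. cmod (\<Sum>\<^sub>\<infinity>y. K x y * u y)) F) (finite_subsets_at_top UNIV)"
    unfolding L2_set_def
    by (intro tendsto_intros infsum_tendsto summable_l2_mult[OF l2_bound_row[OF K] u])
  have "eventually (\<lambda>Y. L2_set (\<lambda>x. cmod (\<Sum>y\<in>Y. K x y * u y)) F \<le> C * c) (finite_subsets_at_top UNIV)"
  proof (rule eventually_finite_subsets_at_top_weakI)
    fix Y :: "'a set" assume Y: "finite Y"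
    have "L2_set (\<lambda>x. cmod (\<Sum>y\<in>Y. K x y * u y)) F \<le> C * L2_set (\<lambda>y. cmod (u y)) Y"
      by (rule mat_boundD[OF K F Y])
    also have "\<dots> \<le> C * c"
      by (intro mult_left_mono l2_boundD[OF u Y] mat_bound_nonneg[OF K])
    finally show "L2_set (\<lambda>x. cmod (\<Sum>y\<in>Y. K x y * u y)) F \<le> C * c" .
  qed
  thus "L2_set (\<lambda>x. cmod (\<Sum>\<^sub>\<infinity>y. K x y * u y)) F \<le> C * c"
    by (rule tendsto_upperbound[OF lim]) simp
qed

lemma l2_bound_tail:
  assumes u: "l2_bound u c" and e: "e > 0"
  shows "\<exists>W. finite W \<and> l2_bound (\<lambda>x. if x \<in> W then 0 else u x) e"
proof -
  define q where "q x = (cmod (u x))\<^sup>2" for x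
  have "sum q F \<le> c\<^sup>2" if "finite F" for F
    using power_mono[OF l2_boundD[OF u that] L2_set_nonneg, of 2]
    by (simp add: L2_set_def q_def sum_nonneg)
  hence sm: "q summable_on UNIV"
    by (intro nonneg_bdd_above_summable_on) (auto simp: q_def intro!: bdd_aboveI)
  have "eventually (\<lambda>W. dist (sum q W) (infsum q UNIV) < e\<^sup>2) (finite_subsets_at_top UNIV)"
    using infsum_tendsto[OF sm] e by (intro tendstoD) auto
  then obtain W where W: "finite W" "dist (sum q W) (infsum q UNIV) < e\<^sup>2"
    by (auto simp: eventually_finite_subsets_at_top)
  have "L2_set (\<lambda>x. cmod (if x \<in> W then 0 else u x)) F \<le> e" if F: "finite F" for F
  proof -
    have "sum q W + sum q (F - W) = sum q (W \<union> F)"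
      using W F by (subst sum.union_disjoint[symmetric]) (auto intro: arg_cong[where f = "sum q"])
    also have "\<dots> \<le> infsum q UNIV"
      by (rule finite_sum_le_infsum[OF sm]) (use W F in \<open>auto simp: q_def\<close>)
    finally have "sum q (F - W) \<le> e\<^sup>2" using W(2) by (simp add: dist_real_def)
    moreover have "(\<Sum>x\<in>F. (cmod (if x \<in> W then 0 else u x))\<^sup>2) = sum q (F - W)"
      using F by (intro sum.mono_neutral_cong_right) (auto simp: q_def)
    ultimately show ?thesis
      unfolding L2_set_def using e by (intro real_le_lsqrt) auto
  qed
  thus ?thesis using W(1) e by (auto simp: l2_bound_def)
qed

text \<open>The double sum need not converge absolutely, so Fubini is not available. Instead both iterated
  sums are bounded linear in \<open>m\<close> with the same bound, and they agree when \<open>m\<close> has finite support.\<close>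

lemma infsum_l2_bilinear_swap:
  assumes r: "l2_bound r c" and K: "mat_bound K C" and m: "l2_bound m d"
  shows "(\<Sum>\<^sub>\<infinity>w. (\<Sum>\<^sub>\<infinity>z. r z * K z w) * m w) = (\<Sum>\<^sub>\<infinity>z. r z * (\<Sum>\<^sub>\<infinity>w. K z w * m w))"
    (is "?l = ?r")
proof -
  define q where "q w = (\<Sum>\<^sub>\<infinity>z. r z * K z w)" for w
  have q: "l2_bound q (C * c)"
    using l2_bound_mat_vec[OF mat_bound_transpose[OF K] r] by (simp add: q_def[abs_def] mult.commute)
  have "cmod (?l - ?r) \<le> 2 * C * c * e" if e: "e > 0" for e
  proof -
    obtain W where W: "finite W" and tail: "l2_bound (\<lambda>x. if x \<in> W then 0 else m x) e"
      using l2_bound_tail[OF m e] by blast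
    \<comment> \<open>The part of \<open>m\<close> outside a finite set carrying almost all of its norm.\<close>
    define m' where "m' x = (if x \<in> W then 0 else m x)" for x
    have m': "l2_bound m' e" using tail by (simp add: m'_def[abs_def])
    have split: "(\<Sum>\<^sub>\<infinity>w. f w * m w) = (\<Sum>w\<in>W. f w * m w) + (\<Sum>\<^sub>\<infinity>w. f w * m' w)"
      if f: "l2_bound f b" for f b
    proof -
      have sm: "(\<lambda>w. f w * m' w) summable_on UNIV" by (rule summable_l2_mult[OF f m'])
      have "((\<lambda>w. if w \<in> W then f w * m w else 0) has_sum (\<Sum>w\<in>W. f w * m w)) UNIV"
        using has_sum_finite[OF W, of "\<lambda>w. f w * m w"]
        by (rule has_sum_cong_neutral[THEN iffD1, rotated -1]) auto
      from has_sum_add[OF this has_sum_infsum[OF sm]]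
      have "((\<lambda>w. f w * m w) has_sum ((\<Sum>w\<in>W. f w * m w) + (\<Sum>\<^sub>\<infinity>w. f w * m' w))) UNIV"
        by (rule has_sum_cong[THEN iffD1, rotated]) (auto simp: m'_def)
      thus ?thesis by (rule infsumI)
    qed
    have l: "?l = (\<Sum>w\<in>W. q w * m w) + (\<Sum>\<^sub>\<infinity>w. q w * m' w)"
      using split[OF q] by (simp add: q_def)
    have v: "l2_bound (\<lambda>z. \<Sum>w\<in>W. K z w * m w) (C * L2_set (\<lambda>y. cmod (m y)) W)"
      by (rule l2_bound_finite_vec[OF K W])
    have v': "l2_bound (\<lambda>z. \<Sum>\<^sub>\<infinity>w. K z w * m' w) (C * e)"
      by (rule l2_bound_mat_vec[OF K m'])
    have "?r = (\<Sum>\<^sub>\<infinity>z. r z * (\<Sum>w\<in>W. K z w * m w) + r z * (\<Sum>\<^sub>\<infinity>w. K z w * m' w))"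
      by (simp add: split[OF l2_bound_row[OF K]] distrib_left)
    also have "\<dots> = (\<Sum>\<^sub>\<infinity>z. r z * (\<Sum>w\<in>W. K z w * m w)) + (\<Sum>\<^sub>\<infinity>z. r z * (\<Sum>\<^sub>\<infinity>w. K z w * m' w))"
      by (intro infsum_add summable_l2_mult[OF r v] summable_l2_mult[OF r v'])
    also have "(\<Sum>\<^sub>\<infinity>z. r z * (\<Sum>w\<in>W. K z w * m w)) = (\<Sum>\<^sub>\<infinity>z. \<Sum>w\<in>W. r z * K z w * m w)"
      by (simp add: sum_distrib_left mult.assoc)
    also have "\<dots> = (\<Sum>w\<in>W. \<Sum>\<^sub>\<infinity>z. r z * K z w * m w)"
      by (intro infsum_sum summable_on_cmult_left summable_l2_mult[OF r l2_bound_column[OF K]])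
    also have "\<dots> = (\<Sum>w\<in>W. q w * m w)"
      by (simp add: q_def infsum_cmult_left')
    finally have "?l - ?r = (\<Sum>\<^sub>\<infinity>w. q w * m' w) - (\<Sum>\<^sub>\<infinity>z. r z * (\<Sum>\<^sub>\<infinity>w. K z w * m' w))"
      using l by simp
    also have "cmod \<dots> \<le> C * c * e + c * (C * e)"
      by (rule order_trans[OF norm_triangle_ineq4] add_mono)+
        (rule cmod_infsum_l2_mult_le[OF q m'] cmod_infsum_l2_mult_le[OF r v'])+
    finally show ?thesis by (simp add: mult_ac)
  qed
  hence ev: "eventually (\<lambda>e. cmod (?l - ?r) \<le> 2 * C * c * e) (at_right 0)"
    by (rule eventually_mono[OF eventually_at_right_less])
  have lim: "((\<lambda>e. 2 * C * c * e) \<longlongrightarrow> 2 * C * c * 0) (at_right 0)"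
    by (intro tendsto_intros)
  have "cmod (?l - ?r) \<le> 2 * C * c * 0"
    by (rule tendsto_lowerbound[OF lim ev]) simp
  thus ?thesis by simp
qed

lemma mat_bound_mult:
  assumes K: "mat_bound K C" and M: "mat_bound M D"
  shows "mat_bound (mat_mult K M) (C * D)"
proof (rule mat_boundI)
  show "0 \<le> C * D" using mat_bound_nonneg[OF K] mat_bound_nonneg[OF M] by simp
next
  fix F E :: "'a set" and u :: "'a \<Rightarrow> complex" assume fin: "finite F" "finite E"
  define w where "w z = (\<Sum>y\<in>E. M z y * u y)" for z
  have w: "l2_bound w (D * L2_set (\<lambda>y. cmod (u y)) E)"
    unfolding w_def by (rule l2_bound_finite_vec[OF M fin(2)])
  have "(\<Sum>y\<in>E. mat_mult K M x y * u y) = (\<Sum>\<^sub>\<infinity>z. K x z * w z)" for x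
  proof -
    have "(\<Sum>y\<in>E. mat_mult K M x y * u y) = (\<Sum>y\<in>E. \<Sum>\<^sub>\<infinity>z. K x z * M z y * u y)"
      by (simp add: mat_mult_def infsum_cmult_left')
    also have "\<dots> = (\<Sum>\<^sub>\<infinity>z. \<Sum>y\<in>E. K x z * M z y * u y)"
      by (intro infsum_sum[symmetric] summable_on_cmult_left
          summable_l2_mult[OF l2_bound_row[OF K] l2_bound_column[OF M]])
    finally show ?thesis by (simp add: w_def sum_distrib_left mult.assoc)
  qed
  thus "L2_set (\<lambda>x. cmod (\<Sum>y\<in>E. mat_mult K M x y * u y)) F \<le> C * D * L2_set (\<lambda>y. cmod (u y)) E"
    using l2_boundD[OF l2_bound_mat_vec[OF K w] fin(1)] by (simp add: mult.assoc)
qed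

lemma mat_mult_assoc:
  assumes "mat_bound K C" "mat_bound M D" "mat_bound P E"
  shows "mat_mult (mat_mult K M) P = mat_mult K (mat_mult M P)"
  using infsum_l2_bilinear_swap[OF l2_bound_row[OF assms(1)] assms(2) l2_bound_column[OF assms(3)]]
  by (simp add: mat_mult_def fun_eq_iff)

text \<open>The nontrivial half of the C*-identity: \<open>\<parallel>K u\<parallel>\<^sup>2 = \<langle>u, K\<^sup>* K u\<rangle> \<le> D \<parallel>u\<parallel>\<^sup>2\<close> for finitely
  supported \<open>u\<close>.\<close>

lemma mat_bound_sqrt_if_adjoint_mult:
  assumes K: "mat_bound K C" and KK: "mat_bound (mat_mult (\<lambda>y x. cnj (K x y)) K) D"
  shows "mat_bound K (sqrt D)"
proof (rule mat_boundI)
  have D: "D \<ge> 0" by (rule mat_bound_nonneg[OF KK])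
  show "0 \<le> sqrt D" using D by simp
  fix F E :: "'a set" and u :: "'a \<Rightarrow> complex" assume fin: "finite F" "finite E"
  define a where "a = L2_set (\<lambda>y. cmod (u y)) E"
  have a: "a \<ge> 0" unfolding a_def by (rule L2_set_nonneg)
  define v where "v x = (\<Sum>y\<in>E. K x y * u y)" for x
  have v: "l2_bound v (C * a)"
    unfolding v_def a_def by (rule l2_bound_finite_vec[OF K fin(2)])
  have vc: "l2_bound (\<lambda>x. cnj (v x)) (C * a)" using v by (simp add: l2_bound_def)
  have row: "l2_bound (\<lambda>x. cnj (K x y)) C" for y
    by (rule l2_bound_row[OF mat_bound_adjoint[OF K]])
  have KKv: "(\<Sum>\<^sub>\<infinity>x. cnj (K x y) * v x) = (\<Sum>y'\<in>E. mat_mult (\<lambda>y x. cnj (K x y)) K y y' * u y')" for y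
  proof -
    have "(\<Sum>\<^sub>\<infinity>x. cnj (K x y) * v x) = (\<Sum>\<^sub>\<infinity>x. \<Sum>y'\<in>E. cnj (K x y) * K x y' * u y')"
      by (simp add: v_def sum_distrib_left mult.assoc)
    also have "\<dots> = (\<Sum>y'\<in>E. \<Sum>\<^sub>\<infinity>x. cnj (K x y) * K x y' * u y')"
      by (intro infsum_sum summable_on_cmult_left summable_l2_mult[OF row l2_bound_column[OF K]])
    finally show ?thesis by (simp add: mat_mult_def infsum_cmult_left')
  qed
  have sm: "(\<lambda>x. (cmod (v x))\<^sup>2) summable_on UNIV"
    using abs_summable_l2_mult[OF vc v] by (simp add: norm_mult power2_eq_square)
  have "complex_of_real (\<Sum>\<^sub>\<infinity>x. (cmod (v x))\<^sup>2) = (\<Sum>\<^sub>\<infinity>x. cnj (v x) * v x)"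
  proof -
    have "((\<lambda>x. complex_of_real ((cmod (v x))\<^sup>2)) has_sum complex_of_real (\<Sum>\<^sub>\<infinity>x. (cmod (v x))\<^sup>2)) UNIV"
      by (rule has_sum_of_real[OF has_sum_infsum[OF sm]])
    thus ?thesis by (simp only: complex_norm_square mult.commute infsumI[symmetric])
  qed
  also have "\<dots> = (\<Sum>\<^sub>\<infinity>x. \<Sum>y\<in>E. cnj (u y) * (cnj (K x y) * v x))"
  proof -
    have "cnj (v x) = (\<Sum>y\<in>E. cnj (u y) * cnj (K x y))" for x
      by (simp add: v_def mult.commute)
    thus ?thesis by (simp add: sum_distrib_right mult.assoc)
  qed
  also have "\<dots> = (\<Sum>y\<in>E. \<Sum>\<^sub>\<infinity>x. cnj (u y) * (cnj (K x y) * v x))"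
    by (intro infsum_sum summable_on_cmult_right summable_l2_mult[OF row v])
  also have "\<dots> = (\<Sum>y\<in>E. cnj (u y) * (\<Sum>y'\<in>E. mat_mult (\<lambda>y x. cnj (K x y)) K y y' * u y'))"
    by (simp add: infsum_cmult_right' KKv)
  finally have "(\<Sum>\<^sub>\<infinity>x. (cmod (v x))\<^sup>2) =
      cmod (\<Sum>y\<in>E. cnj (u y) * (\<Sum>y'\<in>E. mat_mult (\<lambda>y x. cnj (K x y)) K y y' * u y'))"
    by (metis (no_types, lifting) abs_of_nonneg infsum_nonneg norm_of_real zero_le_power2)
  also have "\<dots> \<le> (\<Sum>y\<in>E. \<bar>cmod (u y)\<bar> * \<bar>cmod (\<Sum>y'\<in>E. mat_mult (\<lambda>y x. cnj (K x y)) K y y' * u y')\<bar>)"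
    by (rule order_trans[OF norm_sum]) (simp add: norm_mult)
  also have "\<dots> \<le> a * L2_set (\<lambda>y. cmod (\<Sum>y'\<in>E. mat_mult (\<lambda>y x. cnj (K x y)) K y y' * u y')) E"
    unfolding a_def by (rule L2_set_mult_ineq)
  also have "\<dots> \<le> a * (D * a)"
    using mat_boundD[OF KK fin(2) fin(2), of u] a by (intro mult_left_mono) (auto simp: a_def)
  finally have "(\<Sum>\<^sub>\<infinity>x. (cmod (v x))\<^sup>2) \<le> D * a\<^sup>2" by (simp add: power2_eq_square mult_ac)
  moreover have "(\<Sum>x\<in>F. (cmod (v x))\<^sup>2) \<le> (\<Sum>\<^sub>\<infinity>x. (cmod (v x))\<^sup>2)"
    by (rule finite_sum_le_infsum[OF sm fin(1)]) auto
  ultimately have "L2_set (\<lambda>x. cmod (v x)) F \<le> sqrt (D * a\<^sup>2)"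
    unfolding L2_set_def by simp
  also have "\<dots> = sqrt D * a" using a by (simp add: real_sqrt_mult)
  finally show "L2_set (\<lambda>x. cmod (\<Sum>y\<in>E. K x y * u y)) F \<le> sqrt D * L2_set (\<lambda>y. cmod (u y)) E"
    by (simp add: v_def a_def)
qed

section \<open>The C*-algebra of bounded matrices\<close>

definition opnorm :: "('a \<Rightarrow> 'a \<Rightarrow> complex) \<Rightarrow> real" where
  "opnorm K = Inf {C. mat_bound K C}"

lemma opnorm_le: "mat_bound K C \<Longrightarrow> opnorm K \<le> C"
  unfolding opnorm_def by (rule cInf_lower) (auto intro!: bdd_belowI[of _ 0] mat_bound_nonneg)

lemma mat_bound_opnorm:
  assumes "mat_bound K C" shows "mat_bound K (opnorm K)"
proof (rule mat_boundI)
  show "0 \<le> opnorm K"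
    unfolding opnorm_def by (rule cInf_greatest) (use assms in \<open>auto intro: mat_bound_nonneg\<close>)
  fix F E :: "'a set" and u :: "'a \<Rightarrow> complex" assume fin: "finite F" "finite E"
  define a where "a = L2_set (\<lambda>y. cmod (u y)) E"
  define b where "b = L2_set (\<lambda>x. cmod (\<Sum>y\<in>E. K x y * u y)) F"
  have le: "b \<le> D * a" if "mat_bound K D" for D
    unfolding a_def b_def by (rule mat_boundD[OF that fin])
  have "b \<le> opnorm K * a"
  proof (cases "a = 0")
    case True thus ?thesis using le[OF assms] by simp
  next
    case False
    hence a: "a > 0" using L2_set_nonneg[of _ E] by (simp add: a_def order.strict_iff_order)
    have "b / a \<le> opnorm K"
      unfolding opnorm_def
      by (rule cInf_greatest) (use assms le a in \<open>auto simp: pos_divide_le_eq\<close>)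
    thus ?thesis using a by (simp add: pos_divide_le_eq)
  qed
  thus "L2_set (\<lambda>x. cmod (\<Sum>y\<in>E. K x y * u y)) F \<le> opnorm K * L2_set (\<lambda>y. cmod (u y)) E"
    by (simp add: a_def b_def)
qed

definition matrix_algebra :: "('a \<Rightarrow> 'a \<Rightarrow> complex) star_algebra" where
  "matrix_algebra =
    \<lparr>carrier = {K. \<exists>C. mat_bound K C},
     mult = mat_mult,
     one = (\<lambda>x y. if x = y then 1 else 0),
     zero = (\<lambda>x y. 0),
     add = (\<lambda>K M x y. K x y + M x y),
     smult = (\<lambda>c K x y. c * K x y),
     invol = (\<lambda>K x y. cnj (K y x)),
     anorm = opnorm\<rparr>"

lemma matrix_algebra_simps [simp]:
  "K \<in> carrier matrix_algebra \<longleftrightarrow> mat_bound K (opnorm K)"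
  "mult matrix_algebra = mat_mult"
  "one matrix_algebra = (\<lambda>x y. if x = y then 1 else 0)"
  "zero matrix_algebra = (\<lambda>x y. 0)"
  "add matrix_algebra = (\<lambda>K M x y. K x y + M x y)"
  "module.smult matrix_algebra = (\<lambda>c K x y. c * K x y)"
  "invol matrix_algebra = (\<lambda>K x y. cnj (K y x))"
  "anorm matrix_algebra = opnorm"
  by (auto simp: matrix_algebra_def intro: mat_bound_opnorm)

lemma mat_mult_one:
  "mat_mult (\<lambda>x y. if x = y then 1 else 0) K = K" "mat_mult K (\<lambda>x y. if x = y then 1 else 0) = K"
proof -
  have "(\<Sum>\<^sub>\<infinity>z. (if x = z then 1 else 0) * K z y) = (\<Sum>\<^sub>\<infinity>z\<in>{x}. K z y)" for x y
    by (rule infsum_cong_neutral) auto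
  moreover have "(\<Sum>\<^sub>\<infinity>z. K x z * (if z = y then 1 else 0)) = (\<Sum>\<^sub>\<infinity>z\<in>{y}. K x z)" for x y
    by (rule infsum_cong_neutral) auto
  ultimately show "mat_mult (\<lambda>x y. if x = y then 1 else 0) K = K"
    "mat_mult K (\<lambda>x y. if x = y then 1 else 0) = K"
    by (simp_all add: mat_mult_def fun_eq_iff)
qed

lemma mat_bound_one: "mat_bound (\<lambda>x y. if x = y then 1 else 0) 1"
proof (rule mat_boundI)
  fix F E :: "'a set" and u :: "'a \<Rightarrow> complex" assume fin: "finite F" "finite E"
  have "(\<Sum>x\<in>F. (cmod (\<Sum>y\<in>E. (if x = y then 1 else 0) * u y))\<^sup>2) = (\<Sum>x\<in>F. if x \<in> E then (cmod (u x))\<^sup>2 else 0)"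
    using fin by (intro sum.cong refl) (simp add: if_distrib[of "\<lambda>c. c * _"] cong: if_cong)
  also have "\<dots> = (\<Sum>x\<in>F \<inter> E. (cmod (u x))\<^sup>2)" using fin by (simp add: sum.inter_restrict)
  also have "\<dots> \<le> (\<Sum>x\<in>E. (cmod (u x))\<^sup>2)" using fin by (intro sum_mono2) auto
  finally show "L2_set (\<lambda>x. cmod (\<Sum>y\<in>E. (if x = y then 1 else 0) * u y)) F \<le> 1 * L2_set (\<lambda>y. cmod (u y)) E"
    by (simp add: L2_set_def)
qed simp

lemma module_matrix_algebra: "module complex_ring (matrix_algebra :: ('a \<Rightarrow> 'a \<Rightarrow> complex) star_algebra)"
proof (rule moduleI)
  show "abelian_group (matrix_algebra :: ('a \<Rightarrow> 'a \<Rightarrow> complex) star_algebra)"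
  proof (rule abelian_groupI)
    fix K :: "'a \<Rightarrow> 'a \<Rightarrow> complex" assume "K \<in> carrier matrix_algebra"
    hence "mat_bound (\<lambda>x y. - K x y) (cmod (-1) * opnorm K)"
      using mat_bound_smult[of K "opnorm K" "-1"] by simp
    thus "\<exists>M\<in>carrier matrix_algebra. M \<oplus>\<^bsub>matrix_algebra\<^esub> K = \<zero>\<^bsub>matrix_algebra\<^esub>"
      by (auto intro!: bexI[of _ "\<lambda>x y. - K x y"] intro: mat_bound_opnorm)
  qed (auto intro: mat_bound_opnorm mat_bound_add mat_bound_zero simp: algebra_simps)
qed (auto intro: cring_complex_ring mat_bound_opnorm mat_bound_smult simp: algebra_simps)

lemma opnorm_adjoint_le:
  assumes "mat_bound K C" shows "opnorm (\<lambda>x y. cnj (K y x)) \<le> opnorm K"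
  by (rule opnorm_le[OF mat_bound_adjoint[OF mat_bound_opnorm[OF assms]]])

lemma minus_matrix_algebra:
  fixes K M :: "'a \<Rightarrow> 'a \<Rightarrow> complex"
  assumes "K \<in> carrier matrix_algebra" "M \<in> carrier matrix_algebra"
  shows "K \<ominus>\<^bsub>matrix_algebra\<^esub> M = (\<lambda>x y. K x y - M x y)"
proof -
  interpret md: module complex_ring "matrix_algebra :: ('a \<Rightarrow> 'a \<Rightarrow> complex) star_algebra"
    by (rule module_matrix_algebra)
  have "mat_bound (\<lambda>x y. - M x y) (cmod (-1) * opnorm M)"
    using mat_bound_smult[of M "opnorm M" "-1"] assms by simp
  hence "\<ominus>\<^bsub>matrix_algebra\<^esub> M = (\<lambda>x y. - M x y)"
    using assms by (intro md.M.minus_equality) (auto intro: mat_bound_opnorm)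
  thus ?thesis by (simp add: a_minus_def)
qed

text \<open>Completeness: entries are dominated by the norm, so a Cauchy sequence converges entrywise, and
  the bound on differences survives in the entrywise limit.\<close>

lemma cstar_algebra_matrix_algebra:
  "cstar_algebra (matrix_algebra :: ('a \<Rightarrow> 'a \<Rightarrow> complex) star_algebra)"
proof -
  interpret module complex_ring "matrix_algebra :: ('a \<Rightarrow> 'a \<Rightarrow> complex) star_algebra"
    by (rule module_matrix_algebra)
  show ?thesis
  proof
    fix K M :: "'a \<Rightarrow> 'a \<Rightarrow> complex" and z
    assume K: "K \<in> carrier matrix_algebra"
    hence bK: "mat_bound K (opnorm K)" by simp
    show "invol matrix_algebra K \<in> carrier matrix_algebra"
      using K by (auto intro: mat_bound_opnorm mat_bound_adjoint)
    show "invol matrix_algebra (invol matrix_algebra K) = K" by simp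
    show "invol matrix_algebra (z \<odot>\<^bsub>matrix_algebra\<^esub> K) = cnj z \<odot>\<^bsub>matrix_algebra\<^esub> invol matrix_algebra K"
      by simp
    show nonneg: "0 \<le> anorm matrix_algebra K" using mat_bound_nonneg[OF bK] by simp
    show "anorm matrix_algebra (invol matrix_algebra K) = anorm matrix_algebra K"
      using opnorm_adjoint_le[OF bK] opnorm_adjoint_le[OF mat_bound_adjoint[OF bK]] by simp
    have smult_le: "opnorm (\<lambda>x y. z * P x y) \<le> cmod z * opnorm P" if "mat_bound P C" for z P C
      by (rule opnorm_le[OF mat_bound_smult[OF mat_bound_opnorm[OF that]]])
    show "anorm matrix_algebra (z \<odot>\<^bsub>matrix_algebra\<^esub> K) = cmod z * anorm matrix_algebra K"
    proof (cases "z = 0")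
      case True
      have "opnorm (\<lambda>x y :: 'a. 0) = 0"
        using opnorm_le[OF mat_bound_zero] mat_bound_nonneg[OF mat_bound_opnorm[OF mat_bound_zero]]
        by (intro antisym)
      with True show ?thesis by simp
    next
      case False
      have "opnorm K \<le> inverse (cmod z) * opnorm (\<lambda>x y. z * K x y)"
        using smult_le[OF mat_bound_smult[OF bK], of "inverse z" z] False
        by (simp add: norm_inverse flip: mult.assoc)
      hence "cmod z * opnorm K \<le> opnorm (\<lambda>x y. z * K x y)"
        using False by (simp add: field_simps)
      thus ?thesis using smult_le[OF bK, of z] by simp
    qed
    show "anorm matrix_algebra K = 0 \<longleftrightarrow> K = \<zero>\<^bsub>matrix_algebra\<^esub>"
    proof
      assume "anorm matrix_algebra K = 0"
      thus "K = \<zero>\<^bsub>matrix_algebra\<^esub>" using cmod_entry_le[OF bK] by (auto simp: fun_eq_iff)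
    next
      assume "K = \<zero>\<^bsub>matrix_algebra\<^esub>"
      thus "anorm matrix_algebra K = 0"
        using opnorm_le[of K 0] mat_bound_zero nonneg by (intro antisym) auto
    qed
    show "anorm matrix_algebra (invol matrix_algebra K \<otimes>\<^bsub>matrix_algebra\<^esub> K) = (anorm matrix_algebra K)\<^sup>2"
    proof (rule antisym)
      have "mat_bound (mat_mult (\<lambda>y x. cnj (K x y)) K) (opnorm K * opnorm K)"
        by (rule mat_bound_mult[OF mat_bound_adjoint[OF bK] bK])
      from opnorm_le[OF this]
      show "anorm matrix_algebra (invol matrix_algebra K \<otimes>\<^bsub>matrix_algebra\<^esub> K) \<le> (anorm matrix_algebra K)\<^sup>2"
        by (simp add: power2_eq_square)
      define D where "D = opnorm (mat_mult (\<lambda>y x. cnj (K x y)) K)"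
      have D: "mat_bound (mat_mult (\<lambda>y x. cnj (K x y)) K) D"
        unfolding D_def by (rule mat_bound_opnorm[OF mat_bound_mult[OF mat_bound_adjoint[OF bK] bK]])
      have "opnorm K \<le> sqrt D"
        by (rule opnorm_le[OF mat_bound_sqrt_if_adjoint_mult[OF bK D]])
      hence "(opnorm K)\<^sup>2 \<le> (sqrt D)\<^sup>2" using mat_bound_nonneg[OF bK] by (intro power_mono)
      thus "(anorm matrix_algebra K)\<^sup>2 \<le> anorm matrix_algebra (invol matrix_algebra K \<otimes>\<^bsub>matrix_algebra\<^esub> K)"
        using mat_bound_nonneg[OF D] by (simp add: D_def)
    qed
    assume unit: "\<And>a. a \<in> carrier matrix_algebra \<Longrightarrow>
        K \<otimes>\<^bsub>matrix_algebra\<^esub> a = a \<and> a \<otimes>\<^bsub>matrix_algebra\<^esub> K = a"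
    show "K = \<one>\<^bsub>matrix_algebra\<^esub>"
      using unit[of "\<one>\<^bsub>matrix_algebra\<^esub>"] mat_bound_opnorm[OF mat_bound_one] by (simp add: mat_mult_one)
  next
    fix K M P :: "'a \<Rightarrow> 'a \<Rightarrow> complex" and z
    assume "K \<in> carrier matrix_algebra" "M \<in> carrier matrix_algebra"
    hence b: "mat_bound K (opnorm K)" "mat_bound M (opnorm M)" by auto
    show "K \<otimes>\<^bsub>matrix_algebra\<^esub> M \<in> carrier matrix_algebra"
      using b by (auto intro: mat_bound_opnorm mat_bound_mult)
    show "anorm matrix_algebra (K \<oplus>\<^bsub>matrix_algebra\<^esub> M) \<le> anorm matrix_algebra K + anorm matrix_algebra M"
      using opnorm_le[OF mat_bound_add[OF b]] by simp
    show "anorm matrix_algebra (K \<otimes>\<^bsub>matrix_algebra\<^esub> M) \<le> anorm matrix_algebra K * anorm matrix_algebra M"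
      using opnorm_le[OF mat_bound_mult[OF b]] by simp
    show "(z \<odot>\<^bsub>matrix_algebra\<^esub> K) \<otimes>\<^bsub>matrix_algebra\<^esub> M = z \<odot>\<^bsub>matrix_algebra\<^esub> (K \<otimes>\<^bsub>matrix_algebra\<^esub> M)"
      by (simp add: mat_mult_def mult.assoc infsum_cmult_right')
    show "K \<otimes>\<^bsub>matrix_algebra\<^esub> (z \<odot>\<^bsub>matrix_algebra\<^esub> M) = z \<odot>\<^bsub>matrix_algebra\<^esub> (K \<otimes>\<^bsub>matrix_algebra\<^esub> M)"
      by (simp add: mat_mult_def mult.left_commute[of _ z] infsum_cmult_right')
    show "invol matrix_algebra (K \<oplus>\<^bsub>matrix_algebra\<^esub> M) = invol matrix_algebra K \<oplus>\<^bsub>matrix_algebra\<^esub> invol matrix_algebra M"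
      by simp
    show "invol matrix_algebra (K \<otimes>\<^bsub>matrix_algebra\<^esub> M) = invol matrix_algebra M \<otimes>\<^bsub>matrix_algebra\<^esub> invol matrix_algebra K"
      by (simp add: mat_mult_def mult.commute flip: infsum_cnj)
    assume "P \<in> carrier matrix_algebra"
    hence P: "mat_bound P (opnorm P)" by simp
    note sm = summable_l2_mult[OF l2_bound_row l2_bound_column]
    show "(K \<otimes>\<^bsub>matrix_algebra\<^esub> M) \<otimes>\<^bsub>matrix_algebra\<^esub> P = K \<otimes>\<^bsub>matrix_algebra\<^esub> (M \<otimes>\<^bsub>matrix_algebra\<^esub> P)"
      using mat_mult_assoc[OF b P] by simp
    show "(K \<oplus>\<^bsub>matrix_algebra\<^esub> M) \<otimes>\<^bsub>matrix_algebra\<^esub> P =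
        K \<otimes>\<^bsub>matrix_algebra\<^esub> P \<oplus>\<^bsub>matrix_algebra\<^esub> M \<otimes>\<^bsub>matrix_algebra\<^esub> P"
      by (simp add: mat_mult_def distrib_right infsum_add sm[OF b(1) P] sm[OF b(2) P])
    show "K \<otimes>\<^bsub>matrix_algebra\<^esub> (M \<oplus>\<^bsub>matrix_algebra\<^esub> P) =
        K \<otimes>\<^bsub>matrix_algebra\<^esub> M \<oplus>\<^bsub>matrix_algebra\<^esub> K \<otimes>\<^bsub>matrix_algebra\<^esub> P"
      by (simp add: mat_mult_def distrib_left infsum_add sm[OF b(1) P] sm[OF b])
  next
    fix X :: "nat \<Rightarrow> 'a \<Rightarrow> 'a \<Rightarrow> complex"
    assume X: "\<And>n. X n \<in> carrier matrix_algebra"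
      and cauchy: "\<And>e. e > 0 \<Longrightarrow> \<exists>M. \<forall>m\<ge>M. \<forall>n\<ge>M. anorm matrix_algebra (X m \<ominus>\<^bsub>matrix_algebra\<^esub> X n) < e"
    define d where "d m n = (\<lambda>x y. X m x y - X n x y)" for m n
    have minus: "X m \<ominus>\<^bsub>matrix_algebra\<^esub> X n = d m n" for m n
      using minus_matrix_algebra[OF X X] by (simp add: d_def)
    have d: "mat_bound (d m n) (opnorm (d m n))" for m n
      using M.minus_closed[OF X X, of m n] minus by simp
    have "Cauchy (\<lambda>n. X n x y)" for x y
    proof (rule metric_CauchyI)
      fix e :: real assume "e > 0"
      then obtain M where M: "\<forall>m\<ge>M. \<forall>n\<ge>M. opnorm (d m n) < e"
        using cauchy[of e] by (auto simp: minus)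
      have "dist (X m x y) (X n x y) \<le> opnorm (d m n)" for m n
        using cmod_entry_le[OF d, where x = x and y = y] by (simp add: d_def dist_norm)
      thus "\<exists>M. \<forall>m\<ge>M. \<forall>n\<ge>M. dist (X m x y) (X n x y) < e"
        using M by (meson le_less_trans)
    qed
    hence "\<exists>l. (\<lambda>n. X n x y) \<longlonglongrightarrow> l" for x y
      using Cauchy_convergent convergent_def by blast
    then obtain K where K: "\<And>x y. (\<lambda>n. X n x y) \<longlonglongrightarrow> K x y" by metis
    have close: "\<exists>M. \<forall>n\<ge>M. mat_bound (\<lambda>x y. X n x y - K x y) e" if e: "e > 0" for e
    proof -
      obtain M where M: "\<forall>m\<ge>M. \<forall>n\<ge>M. opnorm (d m n) < e"
        using cauchy[OF e] by (auto simp: minus)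
      have "mat_bound (\<lambda>x y. X n x y - K x y) e" if n: "n \<ge> M" for n
      proof (rule mat_bound_tendsto[where X = "\<lambda>m. d n m" and \<F> = sequentially])
        show "(\<lambda>m. d n m x y) \<longlonglongrightarrow> X n x y - K x y" for x y
          unfolding d_def by (intro tendsto_intros K)
        show "eventually (\<lambda>m. mat_bound (d n m) e) sequentially"
          using eventually_ge_at_top[of M]
        proof eventually_elim
          case (elim m)
          hence "opnorm (d n m) \<le> e" using M n by (simp add: less_imp_le)
          thus ?case using d[of n m] e unfolding mat_bound_def
            by (meson L2_set_nonneg mult_right_mono order_trans less_imp_le)
        qed
      qed simp
      thus ?thesis by blast
    qed
    obtain M1 where M1: "mat_bound (\<lambda>x y. X M1 x y - K x y) 1" using close[of 1] by auto
    have "mat_bound (\<lambda>x y. X M1 x y + (-1) * (X M1 x y - K x y)) (opnorm (X M1) + cmod (-1) * 1)"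
      using X[of M1] M1 by (intro mat_bound_add mat_bound_smult) auto
    hence Kc: "K \<in> carrier matrix_algebra" by (auto intro: mat_bound_opnorm)
    have "(\<lambda>n. anorm matrix_algebra (X n \<ominus>\<^bsub>matrix_algebra\<^esub> K)) \<longlonglongrightarrow> 0"
    proof (rule LIMSEQ_I)
      fix e :: real assume "e > 0"
      then obtain M where M: "\<forall>n\<ge>M. mat_bound (\<lambda>x y. X n x y - K x y) (e/2)" using close[of "e/2"] by auto
      have "norm (opnorm (\<lambda>x y. X n x y - K x y)) < e" if "n \<ge> M" for n
        using opnorm_le[of "\<lambda>x y. X n x y - K x y" "e/2"] M that \<open>e > 0\<close>
          mat_bound_nonneg[OF mat_bound_opnorm[of "\<lambda>x y. X n x y - K x y" "e/2"]] by auto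
      thus "\<exists>M. \<forall>n\<ge>M. norm (anorm matrix_algebra (X n \<ominus>\<^bsub>matrix_algebra\<^esub> K) - 0) < e"
        by (auto simp: minus_matrix_algebra[OF X Kc])
    qed
    thus "\<exists>l\<in>carrier matrix_algebra. (\<lambda>n. anorm matrix_algebra (X n \<ominus>\<^bsub>matrix_algebra\<^esub> l)) \<longlonglongrightarrow> 0"
      using Kc by blast
  qed
qed

section \<open>Unconditional sums of bounded matrices\<close>

lemma finsum_matrix_algebra:
  fixes f :: "'i \<Rightarrow> 'a \<Rightarrow> 'a \<Rightarrow> complex"
  assumes "finite F" "\<And>i. f i \<in> carrier matrix_algebra"
  shows "finsum matrix_algebra f F = (\<lambda>x y. \<Sum>i\<in>F. f i x y)"
proof -
  interpret cstar_algebra "matrix_algebra :: ('a \<Rightarrow> 'a \<Rightarrow> complex) star_algebra"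
    by (rule cstar_algebra_matrix_algebra)
  from assms(1) show ?thesis
  proof (induction F)
    case (insert i F)
    have "finsum matrix_algebra f (insert i F) = f i \<oplus>\<^bsub>matrix_algebra\<^esub> finsum matrix_algebra f F"
      using insert assms(2) by (intro M.finsum_insert) auto
    thus ?case using insert by simp
  qed (simp only: M.finsum_empty, simp)
qed

lemma alg_infsum_matrix_algebra_single:
  fixes K :: "'a \<Rightarrow> 'a \<Rightarrow> complex"
  assumes K: "K \<in> carrier matrix_algebra"
  shows "alg_infsum matrix_algebra (\<lambda>i. if i = j then K else (\<lambda>x y. 0)) = K"
proof -
  interpret cstar_algebra "matrix_algebra :: ('a \<Rightarrow> 'a \<Rightarrow> complex) star_algebra"
    by (rule cstar_algebra_matrix_algebra)
  let ?f = "\<lambda>i. if i = j then K else (\<lambda>x y. 0)"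
  have f: "?f i \<in> carrier matrix_algebra" for i
    using K M.zero_closed by simp
  have "eventually (\<lambda>F. anorm matrix_algebra (finsum matrix_algebra ?f F \<ominus>\<^bsub>matrix_algebra\<^esub> K) = 0)
      (finite_subsets_at_top UNIV)"
    unfolding eventually_finite_subsets_at_top
  proof (intro exI[of _ "{j}"] conjI allI impI)
    fix F assume F: "finite F \<and> {j} \<subseteq> F \<and> F \<subseteq> UNIV"
    have "finsum matrix_algebra ?f F = (\<lambda>x y. \<Sum>i\<in>F. ?f i x y)"
      using F f by (intro finsum_matrix_algebra) auto
    also have "\<dots> = K" using F by (simp add: if_distribR fun_eq_iff)
    finally show "anorm matrix_algebra (finsum matrix_algebra ?f F \<ominus>\<^bsub>matrix_algebra\<^esub> K) = 0"
      using K M.r_neg[OF K] anorm_zero by (simp only: a_minus_def)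
  qed simp_all
  hence "alg_has_sum matrix_algebra ?f K"
    unfolding alg_has_sum_def using K by (auto intro: tendsto_eventually)
  thus ?thesis by (rule alg_infsum_eqI[OF f])
qed

section \<open>Matrices on a group that live on one diagonal\<close>

lemma group_add_simps:
  fixes x y z :: "'g::group_add"
  shows "x + z - (y + z) = x - y" "x - (- y + x) = y" "x - z + (z - y) = x - y" "z - y + y = z"
    "- (x - z) + x = z" "- y + x - z = - y + (x - z)" "- y + y + z = z" "- y + (y + z) = z"
  by (simp_all add: diff_conv_add_uminus minus_add add.assoc del: add_uminus_conv_diff)

lemma bij_left_translation: "bij (\<lambda>a. - a + x :: 'g::group_add)"
proof (rule bijI')
  fix y show "\<exists>a. y = - a + x" by (rule exI[of _ "x - y"]) (simp add: group_add_simps)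
qed simp

text \<open>A matrix supported on one diagonal is a translation followed by multiplication by its entries, so a
  bound on the entries bounds the operator.\<close>

lemma mat_bound_diagonal:
  fixes E :: "'g::group_add \<Rightarrow> 'g \<Rightarrow> complex"
  assumes le: "\<And>x y. cmod (E x y) \<le> c" and off: "\<And>x y. x - y \<noteq> g \<Longrightarrow> E x y = 0"
  shows "mat_bound E c"
proof (rule mat_boundI)
  show c: "0 \<le> c" using le[of 0 0] norm_ge_zero order_trans by blast
  fix F Y :: "'g set" and u :: "'g \<Rightarrow> complex" assume fin: "finite F" "finite Y"
  define p where "p x = (if - g + x \<in> Y then cmod (u (- g + x)) else 0)" for x
  have supp: "E x y = 0" if "y \<noteq> - g + x" for x y
  proof (rule off)
    show "x - y \<noteq> g" using that by (auto simp: group_add_simps minus_diff_eq)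
  qed
  have "cmod (\<Sum>y\<in>Y. E x y * u y) \<le> c * p x" for x
  proof -
    have "(\<Sum>y\<in>Y. E x y * u y) = (\<Sum>y\<in>Y. if y = - g + x then E x y * u y else 0)"
      by (rule sum.cong) (auto simp: supp)
    also have "\<dots> = (if - g + x \<in> Y then E x (- g + x) * u (- g + x) else 0)"
      using fin by simp
    finally show ?thesis using le[of x "- g + x"] by (auto simp: p_def norm_mult mult_right_mono)
  qed
  hence "L2_set (\<lambda>x. cmod (\<Sum>y\<in>Y. E x y * u y)) F \<le> L2_set (\<lambda>x. c * p x) F"
    by (intro L2_set_mono) auto
  also have "\<dots> = c * L2_set p F" using c by (simp add: L2_set_right_distrib)
  also have "L2_set p F \<le> L2_set (\<lambda>y. cmod (u y)) Y"
  proof -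
    let ?F = "{x \<in> F. - g + x \<in> Y}"
    have "(\<Sum>x\<in>F. (p x)\<^sup>2) = (\<Sum>x\<in>?F. (cmod (u (- g + x)))\<^sup>2)"
      using fin by (intro sum.mono_neutral_cong_right) (auto simp: p_def)
    also have "\<dots> = (\<Sum>y\<in>(\<lambda>x. - g + x) ` ?F. (cmod (u y))\<^sup>2)"
      by (subst sum.reindex) (auto simp: inj_on_def)
    also have "\<dots> \<le> (\<Sum>y\<in>Y. (cmod (u y))\<^sup>2)"
      using fin by (intro sum_mono2) auto
    finally show ?thesis by (simp add: L2_set_def)
  qed
  finally show "L2_set (\<lambda>x. cmod (\<Sum>y\<in>Y. E x y * u y)) F \<le> c * L2_set (\<lambda>y. cmod (u y)) Y"
    using c by (simp add: mult_left_mono)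
qed

lemma cmod_infsum_minus_sum_le:
  fixes t :: "'a \<Rightarrow> complex"
  assumes h: "h summable_on UNIV" and t: "\<And>a. cmod (t a) \<le> h a" and F: "finite F"
  shows "cmod (infsum t UNIV - sum t F) \<le> infsum h UNIV - sum h F"
proof -
  have ta: "(\<lambda>a. cmod (t a)) summable_on UNIV"
    by (rule summable_on_comparison_test[OF h]) (use t in auto)
  hence ts: "t summable_on UNIV" by (rule abs_summable_summable)
  have sub: "f summable_on UNIV \<Longrightarrow> f summable_on (UNIV - F)" for f :: "'a \<Rightarrow> real"
    using summable_on_subset_banach by blast
  have "infsum t UNIV - sum t F = infsum t (UNIV - F)"
    using infsum_Diff[OF ts summable_on_finite[OF F]] F by simp
  also have "cmod \<dots> \<le> infsum (\<lambda>a. cmod (t a)) (UNIV - F)"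
    by (rule norm_infsum_bound[OF sub[OF ta]])
  also have "\<dots> \<le> infsum h (UNIV - F)"
    by (intro infsum_mono sub ta h t)
  also have "\<dots> = infsum h UNIV - sum h F"
    using infsum_Diff[OF h summable_on_finite[OF F]] F by simp
  finally show ?thesis .
qed

section \<open>Twisted kernels and their profiles\<close>

text \<open>The least function dominating \<open>K\<close> in the sense of the norm of twisted kernels. Taking it as a
  representative turns the infimum in that norm into a value.\<close>

definition profile :: "('g::group_add \<Rightarrow> 'g \<Rightarrow> complex) \<Rightarrow> 'g \<Rightarrow> real" where
  "profile K g = (SUP y. cmod (K (g + y) y))"

text \<open>The last assumption is the instance of rigid symmetry for the coefficient algebra in which the
  embedding below takes its values.\<close>

locale twisted_kernels =
  fixes L :: "('g::group_add \<Rightarrow> complex) set" and N :: "('g \<Rightarrow> complex) \<Rightarrow> real"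
    and S :: "('g \<Rightarrow> complex) set" and \<omega> :: "'g \<Rightarrow> 'g \<Rightarrow> 'g \<Rightarrow> complex"
  assumes adm: "admissible_algebra L N"
    and S_alg: "unital_cstar_subalgebra_linf S"
    and S_inv: "translation_invariant S"
    and cocycle: "two_cocycle S \<omega>"
    and symm: "symmetric_banach_star_algebra
      (vector_group_algebra L N (matrix_algebra :: ('g \<Rightarrow> 'g \<Rightarrow> complex) star_algebra))"
begin

abbreviation B :: "('g \<Rightarrow> 'g \<Rightarrow> complex) star_algebra" where "B \<equiv> matrix_algebra"
abbreviation D :: "('g \<Rightarrow> 'g \<Rightarrow> 'g \<Rightarrow> complex) star_algebra" where "D \<equiv> vector_group_algebra L N B"
abbreviation T :: "('g \<Rightarrow> 'g \<Rightarrow> complex) star_algebra" where "T \<equiv> twisted_kernel_algebra L N S \<omega>"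

lemma L_solid: "l \<in> L \<Longrightarrow> (\<And>x. cmod (k x) \<le> cmod (l x)) \<Longrightarrow> k \<in> L"
  and N_mono: "l \<in> L \<Longrightarrow> (\<And>x. cmod (k x) \<le> cmod (l x)) \<Longrightarrow> N k \<le> N l"
  and L_summable: "l \<in> L \<Longrightarrow> (\<lambda>x. cmod (l x)) summable_on UNIV"
  and L_banach: "banach_star_algebra (group_algebra L N)"
  and L_unital: "monoid (group_algebra L N)"
  using adm unfolding admissible_algebra_def by blast+

lemma L_ops:
  assumes k: "k \<in> L" and l: "l \<in> L"
  shows "(\<lambda>x. k x + l x) \<in> L" "(\<lambda>x. z * k x) \<in> L" "(\<lambda>x. cnj (k (- x))) \<in> L"
    "(\<lambda>x. \<Sum>\<^sub>\<infinity>y. k y * l (- y + x)) \<in> L"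
proof -
  interpret banach_star_algebra "group_algebra L N" by (rule L_banach)
  show "(\<lambda>x. k x + l x) \<in> L" "(\<lambda>x. z * k x) \<in> L" "(\<lambda>x. cnj (k (- x))) \<in> L"
    "(\<lambda>x. \<Sum>\<^sub>\<infinity>y. k y * l (- y + x)) \<in> L"
    using M.a_closed[of k l] smult_carrier[of k z] invol_closed[of k] mult_closed[of k l] k l
    by (simp_all add: group_algebra_def)
qed

lemma L_delta: "(\<lambda>x. if x = 0 then 1 else 0) \<in> L"
  using monoid.one_closed[OF L_unital] by (simp add: group_algebra_def)

lemma S_ops:
  shows S_one: "(\<lambda>_. 1) \<in> S"
    and S_add: "f \<in> S \<Longrightarrow> h \<in> S \<Longrightarrow> (\<lambda>x. f x + h x) \<in> S"
    and S_smult: "f \<in> S \<Longrightarrow> (\<lambda>x. c * f x) \<in> S"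
    and S_mult: "f \<in> S \<Longrightarrow> h \<in> S \<Longrightarrow> (\<lambda>x. f x * h x) \<in> S"
    and S_cnj: "f \<in> S \<Longrightarrow> (\<lambda>x. cnj (f x)) \<in> S"
    and S_limit: "(\<And>n. F n \<in> S) \<Longrightarrow> uniform_limit UNIV F h sequentially \<Longrightarrow> h \<in> S"
  using S_alg unfolding unital_cstar_subalgebra_linf_def by blast+

lemma S_const: "(\<lambda>_. c) \<in> S"
  using S_smult[OF S_one, of c] by simp

lemma S_translate: "f \<in> S \<Longrightarrow> (\<lambda>z. f (x + z)) \<in> S"
proof -
  assume "f \<in> S"
  hence "translate (- x) f \<in> S" using S_inv by (auto simp: translation_invariant_def)
  thus ?thesis by (simp add: translate_def)
qed

lemma S_sum: "(\<And>i. i \<in> F \<Longrightarrow> t i \<in> S) \<Longrightarrow> (\<lambda>z. \<Sum>i\<in>F. t i z) \<in> S"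
  by (induction F rule: infinite_finite_induct) (auto intro: S_const S_add)

text \<open>A uniformly dominated series in \<open>S\<close>, possibly uncountably indexed, is still a uniform limit of a
  sequence of finite sums.\<close>

lemma S_infsum:
  assumes t: "\<And>a. t a \<in> S" and h: "h summable_on UNIV" and le: "\<And>a z. cmod (t a z) \<le> h a"
  shows "(\<lambda>z. \<Sum>\<^sub>\<infinity>a. t a z) \<in> S"
proof -
  have "\<exists>F. finite F \<and> infsum h UNIV - sum h F < 1 / Suc n" for n
  proof -
    have "eventually (\<lambda>F. dist (sum h F) (infsum h UNIV) < 1 / Suc n) (finite_subsets_at_top UNIV)"
      using infsum_tendsto[OF h] by (rule tendstoD) simp
    then obtain F where "finite F" "dist (sum h F) (infsum h UNIV) < 1 / Suc n"
      by (auto simp: eventually_finite_subsets_at_top)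
    thus ?thesis by (intro exI[of _ F]) (simp add: dist_real_def)
  qed
  then obtain F where F: "\<And>n. finite (F n)" "\<And>n. infsum h UNIV - sum h (F n) < 1 / Suc n"
    by metis
  have "uniform_limit UNIV (\<lambda>n z. \<Sum>a\<in>F n. t a z) (\<lambda>z. \<Sum>\<^sub>\<infinity>a. t a z) sequentially"
    unfolding uniform_limit_sequentially_iff
  proof (intro allI impI)
    fix e :: real assume "e > 0"
    then obtain M where M: "1 / Suc M < e" using nat_approx_posE by blast
    have "dist (\<Sum>a\<in>F n. t a z) (\<Sum>\<^sub>\<infinity>a. t a z) < e" if n: "n \<ge> M" for n z
    proof -
      have "dist (\<Sum>a\<in>F n. t a z) (\<Sum>\<^sub>\<infinity>a. t a z) \<le> infsum h UNIV - sum h (F n)"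
        using cmod_infsum_minus_sum_le[OF h le F(1)] by (simp add: dist_norm norm_minus_commute)
      also have "\<dots> < 1 / Suc n" by (rule F)
      also have "\<dots> \<le> 1 / Suc M" using n by (simp add: frac_le)
      finally show ?thesis using M by simp
    qed
    thus "\<exists>M. \<forall>n\<ge>M. \<forall>z\<in>UNIV. dist (\<Sum>a\<in>F n. t a z) (\<Sum>\<^sub>\<infinity>a. t a z) < e" by blast
  qed
  thus ?thesis by (rule S_limit[OF S_sum[OF t]])
qed

lemma carrier_T: "K \<in> carrier T \<longleftrightarrow> dominating L K \<noteq> {} \<and> (\<forall>x y. (\<lambda>z. K (x + z) (y + z)) \<in> S)"
  by (simp add: twisted_kernel_algebra_def)

lemma profile_le: "(\<And>x y. cmod (K x y) \<le> cmod (k (x - y))) \<Longrightarrow> profile K g \<le> cmod (k g)"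
  unfolding profile_def by (rule cSUP_least, simp, metis add_diff_cancel)

context
  fixes K assumes K: "K \<in> carrier T"
begin

lemma cmod_le_profile: "cmod (K x y) \<le> profile K (x - y)"
proof -
  obtain k where k: "\<And>x y. cmod (K x y) \<le> cmod (k (x - y))"
    using K by (auto simp: carrier_T dominating_def)
  have "bdd_above (range (\<lambda>u. cmod (K (x - y + u) u)))"
  proof (rule bdd_aboveI2)
    fix u show "cmod (K (x - y + u) u) \<le> cmod (k (x - y))" using k[of "x - y + u" u] by simp
  qed
  from cSUP_upper[OF _ this, of y] show ?thesis by (simp add: profile_def)
qed

lemma profile_nonneg: "0 \<le> profile K g"
  using cmod_le_profile[of g 0] norm_ge_zero[of "K g 0"] by (simp del: norm_ge_zero)

lemma profile_dominating: "(\<lambda>g. complex_of_real (profile K g)) \<in> dominating L K"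
proof -
  obtain k where k: "k \<in> L" "\<And>x y. cmod (K x y) \<le> cmod (k (x - y))"
    using K by (auto simp: carrier_T dominating_def)
  have "(\<lambda>g. complex_of_real (profile K g)) \<in> L"
    by (rule L_solid[OF k(1)]) (use profile_le[of K k] k(2) profile_nonneg in auto)
  thus ?thesis using cmod_le_profile profile_nonneg by (simp add: dominating_def)
qed

lemma profile_in_L: "(\<lambda>g. complex_of_real (profile K g)) \<in> L"
  using profile_dominating by (simp add: dominating_def)

lemma profile_summable: "profile K summable_on UNIV"
  using L_summable[OF profile_in_L] profile_nonneg by simp

lemma anorm_T: "anorm T K = N (\<lambda>g. complex_of_real (profile K g))"
proof -
  have "Inf (N ` dominating L K) = N (\<lambda>g. complex_of_real (profile K g))"
  proof (rule cInf_eq_minimum)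
    show "N (\<lambda>g. complex_of_real (profile K g)) \<in> N ` dominating L K"
      using profile_dominating by blast
    fix r assume "r \<in> N ` dominating L K"
    then obtain k where k: "k \<in> L" "\<And>x y. cmod (K x y) \<le> cmod (k (x - y))" "r = N k"
      by (auto simp: dominating_def)
    show "N (\<lambda>g. complex_of_real (profile K g)) \<le> r"
      unfolding k(3) by (rule N_mono[OF k(1)]) (use profile_le[of K k] k(2) profile_nonneg in auto)
  qed
  thus ?thesis by (simp add: twisted_kernel_algebra_def)
qed

end

lemma carrier_T_I:
  assumes "k \<in> L" "\<And>x y. cmod (K x y) \<le> cmod (k (x - y))" "\<And>x y. (\<lambda>z. K (x + z) (y + z)) \<in> S"
  shows "K \<in> carrier T"
  using assms by (auto simp: carrier_T dominating_def)

section \<open>Untwisting and the embedding\<close>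

text \<open>The phase in the twisted product, as a function of \<open>(x, z, y)\<close>, is the cocycle \<open>\<omega>(xz\<^sup>-\<^sup>1, zy\<^sup>-\<^sup>1; x)\<close> on the pair groupoid
  \<open>G \<times> G\<close>. Like every cocycle on a pair groupoid it is a coboundary: fixing the last of
  the three points at the unit of the group gives a function whose coboundary it is.\<close>

definition untwist :: "'g \<Rightarrow> 'g \<Rightarrow> complex" where
  "untwist x y = \<omega> (x - y) y x"

lemma cmod_omega: "cmod (\<omega> x y q) = 1"
  and omega_S: "\<omega> x y \<in> S"
  and omega_0: "\<omega> x 0 q = 1" "\<omega> 0 x q = 1"
  and omega_cocycle: "\<omega> x y q * \<omega> (x + y) z q = \<omega> y z (- x + q) * \<omega> x (y + z) q"
  using cocycle unfolding two_cocycle_def translate_def by auto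

lemma cmod_untwist [simp]: "cmod (untwist x y) = 1"
  by (simp add: untwist_def cmod_omega)

lemma untwist_refl [simp]: "untwist x x = 1"
  by (simp add: untwist_def omega_0)

lemma untwist_nonzero [simp]: "untwist x y \<noteq> 0"
  using cmod_untwist[of x y] by (metis norm_zero zero_neq_one)

text \<open>This is the 2-cocycle identity at \<open>(xz\<^sup>-\<^sup>1, zy\<^sup>-\<^sup>1, y)\<close>, evaluated at \<open>x\<close>. It turns the
  twisted product into the product of matrices.\<close>

lemma omega_untwist: "\<omega> (x - z) (z - y) x * untwist x y = untwist x z * untwist z y"
  using omega_cocycle[of "x - z" "z - y" x y]
  by (simp add: untwist_def group_add_simps mult.commute)

text \<open>The untwisted kernel is cut into its diagonals. On the diagonal \<open>g\<close> it is a bounded function times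
  the unitary that the regular covariant representation of the twisted action on \<open>S\<close> attaches to
  \<open>g\<close>.\<close>

definition emb :: "('g \<Rightarrow> 'g \<Rightarrow> complex) \<Rightarrow> 'g \<Rightarrow> 'g \<Rightarrow> 'g \<Rightarrow> complex" where
  "emb K g x y = (if x - y = g then K x y * untwist x y else 0)"

lemma emb_bound: "K \<in> carrier T \<Longrightarrow> mat_bound (emb K g) (profile K g)"
  using cmod_le_profile[of K] profile_nonneg[of K]
  by (intro mat_bound_diagonal[where g = g]) (auto simp: emb_def norm_mult)

lemma emb_in_B: "K \<in> carrier T \<Longrightarrow> emb K g \<in> carrier B"
  using mat_bound_opnorm[OF emb_bound] by simp

lemma opnorm_emb:
  assumes K: "K \<in> carrier T"
  shows "opnorm (emb K g) = profile K g"
proof (rule antisym)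
  show "opnorm (emb K g) \<le> profile K g" by (rule opnorm_le[OF emb_bound[OF K]])
  have "cmod (K (g + y) y) \<le> opnorm (emb K g)" for y
    using cmod_entry_le[OF mat_bound_opnorm[OF emb_bound[OF K]], of g "g + y" y]
    by (simp add: emb_def norm_mult)
  thus "profile K g \<le> opnorm (emb K g)" unfolding profile_def by (intro cSUP_least) auto
qed

lemma carrier_D: "f \<in> carrier D \<longleftrightarrow> (\<forall>x. f x \<in> carrier B) \<and> (\<lambda>x. opnorm (f x)) summable_on UNIV \<and>
    (\<lambda>x. complex_of_real (opnorm (f x))) \<in> L"
  by (simp add: vector_group_algebra_def)

lemma emb_carrier_D: "K \<in> carrier T \<Longrightarrow> emb K \<in> carrier D"
  by (simp add: carrier_D emb_bound opnorm_emb profile_summable profile_in_L)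

lemma emb_anorm_D: "K \<in> carrier T \<Longrightarrow> anorm D (emb K) = anorm T K"
  by (simp add: anorm_T) (simp add: vector_group_algebra_def opnorm_emb)

lemma emb_inj_on: "inj_on emb (carrier T)"
proof (rule inj_onI)
  fix K M assume "emb K = emb M"
  hence "emb K (x - y) x y = emb M (x - y) x y" for x y by simp
  thus "K = M" by (simp add: emb_def fun_eq_iff)
qed

lemma
  assumes K: "K \<in> carrier T" and M: "M \<in> carrier T"
  defines "h \<equiv> \<lambda>g a. profile K a * profile M (- a + g)"
  shows profile_conv_summable: "h g summable_on UNIV"
    and profile_conv_in_L: "(\<lambda>g. complex_of_real (infsum (h g) UNIV)) \<in> L"
proof -
  define m where "m = infsum (profile M) UNIV"
  have m: "profile M a \<le> m" for a
    using finite_sum_le_infsum[OF profile_summable[OF M], of "{a}"] profile_nonneg[OF M]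
    by (simp add: m_def)
  have nonneg: "0 \<le> h g a" for g a using profile_nonneg[OF K] profile_nonneg[OF M] by (simp add: h_def)
  show sm: "h g summable_on UNIV" for g
  proof (rule summable_on_comparison_test)
    show "(\<lambda>a. profile K a * m) summable_on UNIV"
      by (intro summable_on_cmult_left profile_summable K)
    show "h g a \<le> profile K a * m" for a
      unfolding h_def by (intro mult_left_mono m profile_nonneg K)
  qed (rule nonneg)
  have "(\<Sum>\<^sub>\<infinity>a. complex_of_real (profile K a) * complex_of_real (profile M (- a + g))) =
      complex_of_real (infsum (h g) UNIV)" for g
    using has_sum_of_real[OF has_sum_infsum[OF sm[of g]], where ?'a = complex]
    by (intro infsumI) (simp add: h_def)
  with L_ops(4)[OF profile_in_L[OF K] profile_in_L[OF M]]
  show "(\<lambda>g. complex_of_real (infsum (h g) UNIV)) \<in> L" by simp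
qed

lemma profile_mult_le:
  assumes K: "K \<in> carrier T" and M: "M \<in> carrier T"
  shows "cmod (K x (- a + x) * M (- a + x) y) \<le> profile K a * profile M (- a + (x - y))"
  using cmod_le_profile[OF K, of x "- a + x"] cmod_le_profile[OF M, of "- a + x" y]
    profile_nonneg[OF K]
  by (simp add: norm_mult group_add_simps mult_mono)

text \<open>Indexing the sum by \<open>a = x z\<^sup>-\<^sup>1\<close> makes the dominating series depend on the diagonal \<open>x y\<^sup>-\<^sup>1\<close>
  only.\<close>

lemma mult_T:
  "mult T K M x y = (\<Sum>\<^sub>\<infinity>a. K x (- a + x) * M (- a + x) y * \<omega> a (- a + (x - y)) x)"
proof -
  have "mult T K M x y = (\<Sum>\<^sub>\<infinity>z. K x z * M z y * \<omega> (x - z) (z - y) x)"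
    by (simp add: twisted_kernel_algebra_def)
  also have "\<dots> = (\<Sum>\<^sub>\<infinity>a. K x (- a + x) * M (- a + x) y * \<omega> (x - (- a + x)) (- a + x - y) x)"
    by (rule infsum_reindex_bij_betw[OF bij_left_translation, symmetric])
  finally show ?thesis by (simp add: group_add_simps)
qed

lemma mult_T_mem:
  assumes K: "K \<in> carrier T" and M: "M \<in> carrier T"
  shows "mult T K M \<in> carrier T"
proof (rule carrier_T_I[OF profile_conv_in_L[OF K M]])
  define h where "h g a = profile K a * profile M (- a + g)" for g a
  have h: "h g summable_on UNIV" for g
    unfolding h_def[abs_def] by (rule profile_conv_summable[OF K M])
  have le: "cmod (K x (- a + x) * M (- a + x) y * \<omega> a (- a + (x - y)) q) \<le> h (x - y) a" for x y a q
    using profile_mult_le[OF K M] by (simp add: norm_mult cmod_omega h_def)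
  fix x y
  have "cmod (mult T K M x y) \<le> infsum (h (x - y)) UNIV"
    using cmod_infsum_minus_sum_le[OF h le, of "{}"] by (simp add: mult_T)
  also have "\<dots> \<le> cmod (complex_of_real (infsum (h (x - y)) UNIV))" by simp
  finally show "cmod (mult T K M x y) \<le>
      cmod (complex_of_real (\<Sum>\<^sub>\<infinity>a. profile K a * profile M (- a + (x - y))))"
    by (simp add: h_def[abs_def])
  have "(\<lambda>z. \<Sum>\<^sub>\<infinity>a. K (x + z) (- a + x + z) * M (- a + x + z) (y + z) * \<omega> a (- a + (x - y)) (x + z)) \<in> S"
  proof (rule S_infsum[OF _ h[of "x - y"]])
    fix a z
    show "(\<lambda>z. K (x + z) (- a + x + z) * M (- a + x + z) (y + z) * \<omega> a (- a + (x - y)) (x + z)) \<in> S"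
      using K M by (intro S_mult S_translate[OF omega_S]) (auto simp: carrier_T)
    show "cmod (K (x + z) (- a + x + z) * M (- a + x + z) (y + z) * \<omega> a (- a + (x - y)) (x + z)) \<le> h (x - y) a"
      using le[of "x + z" a "y + z"] by (simp add: add.assoc group_add_simps)
  qed
  thus "(\<lambda>z. mult T K M (x + z) (y + z)) \<in> S"
    by (simp add: mult_T group_add_simps add.assoc)
qed

text \<open>Diagonals multiply to diagonals, and each entry of the product has a single summand.\<close>

lemma emb_mult_B:
  "mat_mult (emb K a) (emb M (- a + g)) x y =
    (if x - y = g then K x (- a + x) * untwist x (- a + x) * (M (- a + x) y * untwist (- a + x) y) else 0)"
proof -
  have "mat_mult (emb K a) (emb M (- a + g)) x y =
      (\<Sum>\<^sub>\<infinity>z\<in>{- a + x}. emb K a x z * emb M (- a + g) z y)"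
    unfolding mat_mult_def
  proof (rule infsum_cong_neutral)
    fix z assume "z \<in> UNIV - {- a + x}"
    hence "x - z \<noteq> a" by (auto simp: group_add_simps minus_diff_eq)
    thus "emb K a x z * emb M (- a + g) z y = 0" by (simp add: emb_def)
  qed auto
  thus ?thesis by (simp add: emb_def group_add_simps)
qed

text \<open>The finite partial sums of the convolution differ from the proposed value by a matrix on the
  diagonal \<open>g\<close>, so the error is controlled by its entries, and these are bounded by a tail of the
  convolution of the profiles.\<close>

lemma emb_mult_D:
  assumes K: "K \<in> carrier T" and M: "M \<in> carrier T"
  shows "emb (mult T K M) = mult D (emb K) (emb M)"
proof
  fix g
  interpret B: cstar_algebra B by (rule cstar_algebra_matrix_algebra)
  define f where "f a = mat_mult (emb K a) (emb M (- a + g))" for a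
  have f: "f a \<in> carrier B" for a
    using B.mult_closed[OF emb_in_B[OF K] emb_in_B[OF M]] by (simp add: f_def)
  define h where "h a = profile K a * profile M (- a + g)" for a
  have h: "h summable_on UNIV" unfolding h_def[abs_def] by (rule profile_conv_summable[OF K M])
  define t where "t x y a = K x (- a + x) * untwist x (- a + x) * (M (- a + x) y * untwist (- a + x) y)"
    for x y a
  have t_sum: "emb (mult T K M) g x y = infsum (t x y) UNIV" if "x - y = g" for x y
  proof -
    have "mult T K M x y * untwist x y = (\<Sum>\<^sub>\<infinity>a. K x (- a + x) * M (- a + x) y * \<omega> a (- a + (x - y)) x * untwist x y)"
      by (simp add: mult_T infsum_cmult_left')
    also have "\<dots> = infsum (t x y) UNIV"
    proof (rule infsum_cong)
      fix a
      show "K x (- a + x) * M (- a + x) y * \<omega> a (- a + (x - y)) x * untwist x y = t x y a"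
        using omega_untwist[of x "- a + x" y] by (simp add: t_def group_add_simps mult_ac)
    qed
    finally show ?thesis using that by (simp add: emb_def)
  qed
  have E: "emb (mult T K M) g \<in> carrier B" by (rule emb_in_B[OF mult_T_mem[OF K M]])
  have "anorm B (finsum B f F \<ominus>\<^bsub>B\<^esub> emb (mult T K M) g) \<le> infsum h UNIV - sum h F" if F: "finite F" for F
  proof -
    have S: "finsum B f F = (\<lambda>x y. \<Sum>a\<in>F. f a x y)" by (rule finsum_matrix_algebra[OF F f])
    have "finsum B f F \<ominus>\<^bsub>B\<^esub> emb (mult T K M) g =
        (\<lambda>x y. (\<Sum>a\<in>F. f a x y) - emb (mult T K M) g x y)"
      using minus_matrix_algebra[OF B.M.finsum_closed E, of f F] f by (auto simp: S)
    moreover have "opnorm (\<lambda>x y. (\<Sum>a\<in>F. f a x y) - emb (mult T K M) g x y) \<le> infsum h UNIV - sum h F"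
    proof (rule opnorm_le[OF mat_bound_diagonal])
      fix x y
      show "(\<Sum>a\<in>F. f a x y) - emb (mult T K M) g x y = 0" if "x - y \<noteq> g"
        using that by (simp add: f_def emb_mult_B) (simp add: emb_def)
      have tail: "0 \<le> infsum h UNIV - sum h F"
        using finite_sum_le_infsum[OF h F] profile_nonneg K M by (simp add: h_def)
      show "cmod ((\<Sum>a\<in>F. f a x y) - emb (mult T K M) g x y) \<le> infsum h UNIV - sum h F"
      proof (cases "x - y = g")
        case True
        have "cmod (t x y a) \<le> h a" for a
          using profile_mult_le[OF K M, of x a y] True by (simp add: t_def h_def norm_mult)
        from cmod_infsum_minus_sum_le[OF h this F] show ?thesis
          using True by (simp add: t_sum f_def emb_mult_B norm_minus_commute t_def[symmetric])
      next
        case False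
        thus ?thesis using tail by (simp add: f_def emb_mult_B) (simp add: emb_def)
      qed
    qed
    ultimately show ?thesis by simp
  qed
  hence "eventually (\<lambda>F. anorm B (finsum B f F \<ominus>\<^bsub>B\<^esub> emb (mult T K M) g) \<le> infsum h UNIV - sum h F)
      (finite_subsets_at_top UNIV)"
    by (rule eventually_finite_subsets_at_top_weakI)
  moreover have "eventually (\<lambda>F. 0 \<le> anorm B (finsum B f F \<ominus>\<^bsub>B\<^esub> emb (mult T K M) g))
      (finite_subsets_at_top UNIV)"
    using f E by (intro always_eventually allI B.anorm_nonneg B.M.minus_closed B.M.finsum_closed) auto
  moreover have "((\<lambda>F. infsum h UNIV - sum h F) \<longlongrightarrow> infsum h UNIV - infsum h UNIV) (finite_subsets_at_top UNIV)"
    by (intro tendsto_intros infsum_tendsto h)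
  ultimately have "((\<lambda>F. anorm B (finsum B f F \<ominus>\<^bsub>B\<^esub> emb (mult T K M) g)) \<longlongrightarrow> 0) (finite_subsets_at_top UNIV)"
    using tendsto_sandwich[OF _ _ tendsto_const] by fastforce
  hence "alg_has_sum B f (emb (mult T K M) g)" using E unfolding alg_has_sum_def by blast
  from B.alg_infsum_eqI[OF f this]
  show "emb (mult T K M) g = mult D (emb K) (emb M) g"
    by (simp add: vector_group_algebra_def f_def[abs_def])
qed

lemma T_simps:
  "one T = (\<lambda>x y. if x = y then 1 else 0)" "zero T = (\<lambda>x y. 0)"
  "add T = (\<lambda>K M x y. K x y + M x y)" "module.smult T = (\<lambda>c K x y. c * K x y)"
  "invol T = (\<lambda>K x y. cnj (\<omega> (x - y) (y - x) x) * cnj (K y x))"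
  by (simp_all add: twisted_kernel_algebra_def)

lemma D_simps:
  "one D = (\<lambda>g. if g = 0 then one B else zero B)" "zero D = (\<lambda>g. zero B)"
  "add D = (\<lambda>f h g. f g \<oplus>\<^bsub>B\<^esub> h g)" "module.smult D = (\<lambda>c f g. c \<odot>\<^bsub>B\<^esub> f g)"
  "invol D = (\<lambda>f g. invol B (f (- g)))" 
  "mult D = (\<lambda>f h g. alg_infsum B (\<lambda>y. f y \<otimes>\<^bsub>B\<^esub> h (- y + g)))"
  by (simp_all add: vector_group_algebra_def)

lemma one_T_mem: "one T \<in> carrier T"
  by (rule carrier_T_I[OF L_delta]) (auto simp: T_simps intro: S_const)

lemma zero_T_mem: "zero T \<in> carrier T"
  by (rule carrier_T_I[OF L_delta]) (auto simp: T_simps intro: S_const)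

lemma add_T_mem:
  assumes K: "K \<in> carrier T" and M: "M \<in> carrier T"
  shows "add T K M \<in> carrier T"
proof (rule carrier_T_I[OF L_ops(1)[OF profile_in_L[OF K] profile_in_L[OF M]]])
  fix x y
  have "cmod (K x y + M x y) \<le> profile K (x - y) + profile M (x - y)"
    using norm_triangle_ineq[of "K x y" "M x y"] cmod_le_profile[OF K, of x y] cmod_le_profile[OF M, of x y]
    by linarith
  thus "cmod (add T K M x y) \<le> cmod (complex_of_real (profile K (x - y)) + complex_of_real (profile M (x - y)))"
    by (simp add: T_simps flip: of_real_add)
  show "(\<lambda>z. add T K M (x + z) (y + z)) \<in> S"
    using K M by (simp add: T_simps carrier_T S_add)
qed

lemma smult_T_mem:
  assumes K: "K \<in> carrier T"
  shows "module.smult T c K \<in> carrier T"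
proof (rule carrier_T_I[OF L_ops(2)[OF profile_in_L[OF K] profile_in_L[OF K]]])
  fix x y
  show "cmod (module.smult T c K x y) \<le> cmod (c * complex_of_real (profile K (x - y)))"
    using cmod_le_profile[OF K, of x y] by (simp add: T_simps norm_mult mult_left_mono)
  show "(\<lambda>z. module.smult T c K (x + z) (y + z)) \<in> S"
    using K by (simp add: T_simps carrier_T S_smult)
qed

lemma invol_T_mem:
  assumes K: "K \<in> carrier T"
  shows "invol T K \<in> carrier T"
proof (rule carrier_T_I[OF L_ops(3)[OF profile_in_L[OF K] profile_in_L[OF K]]])
  fix x y
  show "cmod (invol T K x y) \<le> cmod (cnj (complex_of_real (profile K (- (x - y)))))"
    using cmod_le_profile[OF K, of y x] by (simp add: T_simps norm_mult cmod_omega)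
  show "(\<lambda>z. invol T K (x + z) (y + z)) \<in> S"
    using K by (auto simp: T_simps carrier_T group_add_simps intro!: S_mult S_cnj S_translate[OF omega_S])
qed

lemma emb_one_D: "emb (one T) = one D"
  by (auto simp: emb_def fun_eq_iff T_simps D_simps)

lemma emb_zero_D: "emb (zero T) = zero D"
  by (auto simp: emb_def fun_eq_iff T_simps D_simps)

lemma emb_add_D: "emb (add T K M) = add D (emb K) (emb M)"
  by (auto simp: emb_def fun_eq_iff T_simps D_simps distrib_right)

lemma emb_smult_D: "emb (module.smult T c K) = module.smult D c (emb K)"
  by (auto simp: emb_def fun_eq_iff T_simps D_simps)

lemma emb_invol_D: "emb (invol T K) = invol D (emb K)"
proof -
  have "cnj (\<omega> (x - y) (y - x) x) * untwist x y = cnj (untwist y x)" for x y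
  proof -
    have "\<omega> (x - y) (y - x) x = untwist x y * untwist y x"
      using omega_untwist[of x y x] by simp
    moreover have "untwist x y * cnj (untwist x y) = 1"
      using complex_norm_square[of "untwist x y"] by simp
    ultimately show ?thesis by (simp add: mult_ac)
  qed
  hence "cnj (\<omega> (x - y) (y - x) x) * cnj (K y x) * untwist x y = cnj (K y x * untwist y x)" for x y
    by (metis complex_cnj_mult mult.assoc mult.commute)
  moreover have "y - x = - g \<longleftrightarrow> x - y = g" for x y g :: 'g
    by (metis minus_diff_eq minus_minus)
  ultimately show ?thesis by (auto simp: emb_def fun_eq_iff T_simps D_simps)
qed

lemma monoid_D: "monoid D"
proof -
  interpret D: symmetric_banach_star_algebra D by (rule symm)
  interpret B: cstar_algebra B by (rule cstar_algebra_matrix_algebra)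
  have zero_mult: "mat_mult (\<lambda>x y. 0) K = (\<lambda>x y. 0)" "mat_mult K (\<lambda>x y. 0) = (\<lambda>x y. 0)"
    for K :: "'g \<Rightarrow> 'g \<Rightarrow> complex" by (simp_all add: mat_mult_def)
  show ?thesis
  proof (rule monoidI)
    show "one D \<in> carrier D" using emb_carrier_D[OF one_T_mem] by (simp only: emb_one_D)
    fix f assume f: "f \<in> carrier D"
    hence fB: "f g \<in> carrier B" for g by (simp add: carrier_D)
    have "one D a \<otimes>\<^bsub>B\<^esub> f (- a + g) = (if a = 0 then f g else (\<lambda>x y. 0))" for a g
      by (simp add: D_simps mat_mult_one zero_mult)
    thus "mult D (one D) f = f"
      by (simp only: D_simps(6) alg_infsum_matrix_algebra_single[OF fB])
    have "f a \<otimes>\<^bsub>B\<^esub> one D (- a + g) = (if a = g then f g else (\<lambda>x y. 0))" for a g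
      by (auto simp: D_simps mat_mult_one zero_mult add_eq_0_iff)
    thus "mult D f (one D) = f"
      by (simp only: D_simps(6) alg_infsum_matrix_algebra_single[OF fB])
  qed (auto simp: D.mult_closed D.mult_assoc)
qed

text \<open>Up to a constant the norm of \<open>D\<close> dominates the \<open>\<ell>\<^sup>1\<close>-norm, hence all entries uniformly. So the limit is again
  carried by the diagonals, and the kernel read off from it is a uniform limit of kernels, which keeps
  the functions \<open>z \<mapsto> K(xz, yz)\<close> in \<open>S\<close>.\<close>

lemma emb_closed_D:
  assumes X: "\<And>n :: nat. X n \<in> carrier T" and l: "l \<in> carrier D"
    and lim: "(\<lambda>n. anorm D (emb (X n) \<ominus>\<^bsub>D\<^esub> l)) \<longlonglongrightarrow> 0"
  shows "l \<in> emb ` carrier T"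
proof -
  interpret D: symmetric_banach_star_algebra D by (rule symm)
  interpret B: cstar_algebra B by (rule cstar_algebra_matrix_algebra)
  have lB: "l g \<in> carrier B" for g using l by (simp add: carrier_D)
  obtain C where C: "\<And>k. k \<in> L \<Longrightarrow> (\<Sum>\<^sub>\<infinity>x. cmod (k x)) \<le> C * N k"
    using adm unfolding admissible_algebra_def by blast
  define e where "e n = C * anorm D (emb (X n) \<ominus>\<^bsub>D\<^esub> l)" for n
  have e: "e \<longlonglongrightarrow> 0" unfolding e_def[abs_def] using tendsto_mult_right_zero[OF lim] .
  have entry: "cmod (emb (X n) g x y - l g x y) \<le> e n" for n g x y
  proof -
    define d where "d = emb (X n) \<ominus>\<^bsub>D\<^esub> l"
    have d: "d \<in> carrier D" unfolding d_def using emb_carrier_D[OF X] l by simp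
    have dxy: "d g x y = emb (X n) g x y - l g x y"
      unfolding d_def using D.minus_eq_add_smult[OF emb_carrier_D[OF X] l, of n] by (simp add: D_simps)
    have dL: "(\<lambda>x. complex_of_real (opnorm (d x))) \<in> L" and dB: "\<And>g. mat_bound (d g) (opnorm (d g))"
      and ds: "(\<lambda>x. opnorm (d x)) summable_on UNIV"
      using d by (auto simp: carrier_D)
    have nn: "0 \<le> opnorm (d g)" for g using mat_bound_nonneg[OF dB] .
    have "cmod (d g x y) \<le> opnorm (d g)" by (rule cmod_entry_le[OF dB])
    also have "\<dots> \<le> (\<Sum>\<^sub>\<infinity>g. opnorm (d g))"
      using finite_sum_le_infsum[OF ds, of "{g}"] nn by simp
    also have "\<dots> \<le> C * N (\<lambda>x. complex_of_real (opnorm (d x)))"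
      using C[OF dL] nn by simp
    also have "\<dots> = e n" by (simp add: e_def d_def[symmetric]) (simp add: vector_group_algebra_def)
    finally show ?thesis by (simp add: dxy)
  qed
  have off: "l g x y = 0" if "x - y \<noteq> g" for g x y
  proof -
    have "cmod (l g x y) \<le> e n" for n using entry[of n g x y] that by (simp add: emb_def)
    hence "cmod (l g x y) \<le> 0" by (intro LIMSEQ_le_const[OF e]) auto
    thus ?thesis by simp
  qed
  define K where "K x y = l (x - y) x y * cnj (untwist x y)" for x y
  have untwist_cnj: "cnj (untwist x y) * untwist x y = 1" for x y
    using complex_norm_square[of "untwist x y"] by (simp add: mult.commute)
  have embK: "emb K = l"
    by (auto simp: fun_eq_iff emb_def K_def mult.assoc untwist_cnj off)
  have KX: "cmod (X n x y - K x y) \<le> e n" for n x y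
  proof -
    have "cmod (X n x y - K x y) = cmod ((X n x y - K x y) * untwist x y)" by (simp add: norm_mult)
    also have "(X n x y - K x y) * untwist x y = emb (X n) (x - y) x y - l (x - y) x y"
      by (simp add: emb_def K_def left_diff_distrib mult.assoc untwist_cnj)
    finally show ?thesis using entry by simp
  qed
  have "K \<in> carrier T"
  proof (rule carrier_T_I)
    show "(\<lambda>g. complex_of_real (opnorm (l g))) \<in> L" using l by (simp add: carrier_D)
    fix x y
    have "cmod (l (x - y) x y) \<le> opnorm (l (x - y))"
      using lB by (intro cmod_entry_le) simp
    thus "cmod (K x y) \<le> cmod (complex_of_real (opnorm (l (x - y))))" by (simp add: K_def norm_mult)
    show "(\<lambda>z. K (x + z) (y + z)) \<in> S"
    proof (rule S_limit)
      show "(\<lambda>z. X n (x + z) (y + z)) \<in> S" for n using X by (simp add: carrier_T)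
      show "uniform_limit UNIV (\<lambda>n z. X n (x + z) (y + z)) (\<lambda>z. K (x + z) (y + z)) sequentially"
        unfolding uniform_limit_iff
      proof (intro allI impI)
        fix \<epsilon> :: real assume "\<epsilon> > 0"
        from order_tendstoD(2)[OF e this]
        show "\<forall>\<^sub>F n in sequentially. \<forall>z\<in>UNIV. dist (X n (x + z) (y + z)) (K (x + z) (y + z)) < \<epsilon>"
          by eventually_elim (use KX in \<open>auto simp: dist_norm intro: le_less_trans\<close>)
      qed
    qed
  qed
  thus ?thesis using embK by blast
qed

lemma isometric_star_embedding_emb: "isometric_star_embedding D T emb"
proof (intro isometric_star_embedding.intro isometric_star_embedding_axioms.intro symm monoid_D emb_inj_on)
  fix X :: "nat \<Rightarrow> 'g \<Rightarrow> 'g \<Rightarrow> complex" and l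
  assume "\<And>n. X n \<in> carrier T" "l \<in> carrier D" "(\<lambda>n. anorm D (emb (X n) \<ominus>\<^bsub>D\<^esub> l)) \<longlonglongrightarrow> 0"
  thus "l \<in> emb ` carrier T" by (rule emb_closed_D)
qed (simp_all only: emb_carrier_D emb_anorm_D mult_T_mem emb_mult_D one_T_mem zero_T_mem add_T_mem
    smult_T_mem invol_T_mem emb_one_D emb_zero_D emb_add_D emb_smult_D emb_invol_D)

end

theorem corollary3p13:
  fixes L :: "('g::group_add \<Rightarrow> complex) set"
    and N :: "('g \<Rightarrow> complex) \<Rightarrow> real"
    and S :: "('g \<Rightarrow> complex) set"
    and \<omega> :: "'g \<Rightarrow> 'g \<Rightarrow> 'g \<Rightarrow> complex"
  assumes "admissible_algebra L N"
    and "rigidly_symmetric TYPE('g \<Rightarrow> 'g \<Rightarrow> complex) L N"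
    and "unital_cstar_subalgebra_linf S"
    and "translation_invariant S"
    and "two_cocycle S \<omega>"
  shows "symmetric_banach_star_algebra (twisted_kernel_algebra L N S \<omega>)"
proof -
  interpret twisted_kernels L N S \<omega>
    using assms cstar_algebra_matrix_algebra[where 'a = 'g]
    by (simp add: twisted_kernels_def rigidly_symmetric_def)
  interpret isometric_star_embedding D T emb
    by (rule isometric_star_embedding_emb)
  show ?thesis by (rule symmetric_source)
qed

end
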